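(* Let $\mathcal T$ and $\widetilde{\mathcal T}$ be compact self-adjoint nonnegative operators in Hilbert spaces $H$ and $\widetilde H$, respectively, and suppose that $$\mathcal N(t,\mathcal T)\sim\varphi(1/t),\qquad \mathcal N(t,\widetilde{\mathcal T})\sim\widetilde\varphi(1/t),\qquad t\to0+,$$ where $\varphi$ and $\widetilde\varphi$ are nondecreasing unbounded functions on $(0,\infty)$ of class $C^2$, slowly varying at infinity. Then the operator $\mathcal T\otimes\widetilde{\mathcal T}$ in $H\otimes\widetilde H$ satisfies $$\mathcal N(t,\mathcal T\otimes\widetilde{\mathcal T})\sim(\varphi\star\widetilde\varphi)(1/t),\qquad t\to0+.$$
   Context: A positive function $\varphi(\tau)$, $\tau>0$, is slowly varying at infinity if $\varphi(c\tau)/\varphi(\tau)\to1$ as $\tau\to+\infty$ for every $c>0$. For nondecreasing unbounded slowly varying functions $\varphi,\psi$, the asymptotic convolution is $$(\varphi\star\psi)(\tau)=\int_1^\tau\varphi(\tau/\sigma)\,d\psi(\sigma),\qquad \tau\ge1.$$ For a compact self-adjoint nonnegative operator $\mathcal T$, $\lambda_n(\mathcal T)$ denotes its positive eigenvalues repeated according to multiplicity, and $\mathcal N(t,\mathcal T)=\#\{n:\lambda_n(\mathcal T)>t\}$, $t>0$, is its counting function. The notation $f\sim g$ means $f/g\to1$. *)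

theory Defs
  imports "HOL-Analysis.Analysis" "HOL-Library.Landau_Symbols" "HOL-Library.Nonpos_Ints"
begin

text \<open>
  The scalar field of a Hilbert space is \<open>\<real>\<close> or \<open>\<complex>\<close>. The class below treats both at once: by the
  Gelfand--Mazur theorem its only models are these two, with the usual absolute value, and
  \<open>conjugate\<close> is then the identity, respectively complex conjugation.
\<close>

class rc_field = real_normed_field +
  fixes conjugate :: "'a \<Rightarrow> 'a"
  assumes conjugate_add: "conjugate (x + y) = conjugate x + conjugate y"
    and mult_conjugate: "x * conjugate x = (norm x)\<^sup>2 *\<^sub>R 1"

instantiation real :: rc_field
begin
definition conjugate_real :: "real \<Rightarrow> real" where "conjugate_real x = x"
instance by standard (auto simp: conjugate_real_def power2_eq_square)
end

instantiation complex :: rc_field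
begin
definition conjugate_complex :: "complex \<Rightarrow> complex" where "conjugate_complex = cnj"
instance
  by standard
    (simp_all add: conjugate_complex_def scaleR_conv_of_real complex_norm_square del: of_real_power)
end

text \<open>
  A Hilbert space over \<open>'k\<close> is a Banach space with a compatible \<open>'k\<close>-vector space structure whose
  norm comes from an inner product, linear in its first argument.
\<close>

locale hilbert_space = vector_space scl
  for scl :: "'k::rc_field \<Rightarrow> 'a::banach \<Rightarrow> 'a" +
  fixes ip :: "'a \<Rightarrow> 'a \<Rightarrow> 'k"
  assumes scale_of_real: "scl (of_real r) x = r *\<^sub>R x"
    and ip_add_left: "ip (x + y) z = ip x z + ip y z"
    and ip_scale_left: "ip (scl c x) y = c * ip x y"
    and ip_commute: "ip y x = conjugate (ip x y)"
    and ip_self: "ip x x = of_real ((norm x)\<^sup>2)"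

lemma hilbert_space_inner:
  "hilbert_space scaleR (inner :: 'a::{real_inner,banach} \<Rightarrow> 'a \<Rightarrow> real)"
  by unfold_locales
    (auto simp: conjugate_real_def inner_commute inner_add_left inner_add_right scaleR_add_right scaleR_add_left
      power2_norm_eq_inner)

definition compact_operator :: "('k::field \<Rightarrow> 'a::real_normed_vector \<Rightarrow> 'a) \<Rightarrow> ('a \<Rightarrow> 'a) \<Rightarrow> bool"
  where "compact_operator scl T \<longleftrightarrow>
    Vector_Spaces.linear scl scl T \<and> (\<forall>B. bounded B \<longrightarrow> compact (closure (T ` B)))"

definition self_adjoint :: "('a \<Rightarrow> 'a \<Rightarrow> 'k) \<Rightarrow> ('a \<Rightarrow> 'a) \<Rightarrow> bool"
  where "self_adjoint ip T \<longleftrightarrow> (\<forall>x y. ip (T x) y = ip x (T y))"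

definition nonneg_operator :: "('a \<Rightarrow> 'a \<Rightarrow> 'k::real_algebra_1) \<Rightarrow> ('a \<Rightarrow> 'a) \<Rightarrow> bool"
  where "nonneg_operator ip T \<longleftrightarrow> (\<forall>x. ip (T x) x \<in> \<real>\<^sub>\<ge>\<^sub>0)"

definition eigenspace ::
  "('k::real_normed_field \<Rightarrow> 'a::ab_group_add \<Rightarrow> 'a) \<Rightarrow> ('a \<Rightarrow> 'a) \<Rightarrow> real \<Rightarrow> 'a set"
  where "eigenspace scl T \<mu> = {x. T x = scl (of_real \<mu>) x}"

text \<open>
  Each positive eigenvalue \<open>\<mu>\<close> of multiplicity \<open>m\<close> contributes the indices \<open>(\<mu>, 0), \<dots>, (\<mu>, m - 1)\<close>;
  the eigenvalue with index \<open>n\<close> is \<open>fst n\<close>. The dimension in \<^locale>\<open>vector_space\<close> is \<open>0\<close> for infinite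
  dimensional subspaces, but eigenspaces of compact operators for \<open>\<mu> > 0\<close> are finite dimensional.
\<close>

definition eigenvalue_indices ::
  "('k::real_normed_field \<Rightarrow> 'a::ab_group_add \<Rightarrow> 'a) \<Rightarrow> ('a \<Rightarrow> 'a) \<Rightarrow> (real \<times> nat) set"
  where "eigenvalue_indices scl T =
    {(\<mu>, k). 0 < \<mu> \<and> k < vector_space.dim scl (eigenspace scl T \<mu>)}"

definition counting_function ::
  "('k::real_normed_field \<Rightarrow> 'a::ab_group_add \<Rightarrow> 'a) \<Rightarrow> real \<Rightarrow> ('a \<Rightarrow> 'a) \<Rightarrow> nat"
  where "counting_function scl t T = card {n \<in> eigenvalue_indices scl T. fst n > t}"

text \<open>
  The conditions determine \<open>(K, \<otimes>)\<close> up to a unique unitary map that respects the elementary tensors.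
\<close>

locale hilbert_tensor_product =
  H: hilbert_space scaleH ipH + G: hilbert_space scaleG ipG + K: hilbert_space scaleK ipK
  for scaleH :: "'k::rc_field \<Rightarrow> 'a::banach \<Rightarrow> 'a" and ipH :: "'a \<Rightarrow> 'a \<Rightarrow> 'k"
    and scaleG :: "'k \<Rightarrow> 'b::banach \<Rightarrow> 'b" and ipG :: "'b \<Rightarrow> 'b \<Rightarrow> 'k"
    and scaleK :: "'k \<Rightarrow> 'c::banach \<Rightarrow> 'c" and ipK :: "'c \<Rightarrow> 'c \<Rightarrow> 'k" +
  fixes tensor :: "'a \<Rightarrow> 'b \<Rightarrow> 'c"
  assumes linear_left: "Vector_Spaces.linear scaleH scaleK (\<lambda>x. tensor x y)"
    and linear_right: "Vector_Spaces.linear scaleG scaleK (\<lambda>y. tensor x y)"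
    and ip_tensor: "ipK (tensor x y) (tensor x' y') = ipH x x' * ipG y y'"
    and dense: "closure (K.span (range (\<lambda>(x, y). tensor x y))) = UNIV"

definition tensor_operator ::
  "('k::field \<Rightarrow> 'c::real_normed_vector \<Rightarrow> 'c) \<Rightarrow> ('a \<Rightarrow> 'b \<Rightarrow> 'c) \<Rightarrow> ('a \<Rightarrow> 'a) \<Rightarrow> ('b \<Rightarrow> 'b) \<Rightarrow> ('c \<Rightarrow> 'c)"
  where "tensor_operator scaleK tensor A B =
    (THE S. Vector_Spaces.linear scaleK scaleK S \<and> bounded_linear S \<and>
      (\<forall>x y. S (tensor x y) = tensor (A x) (B y)))"

text \<open>Functions on \<open>(0, \<infinity>)\<close> are modelled as functions on \<open>\<real>\<close> whose other values are irrelevant.\<close>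

definition slowly_varying :: "(real \<Rightarrow> real) \<Rightarrow> bool"
  where "slowly_varying \<phi> \<longleftrightarrow>
    (\<forall>\<tau>>0. \<phi> \<tau> > 0) \<and> (\<forall>c>0. ((\<lambda>\<tau>. \<phi> (c * \<tau>) / \<phi> \<tau>) \<longlongrightarrow> 1) at_top)"

definition C2_on :: "real set \<Rightarrow> (real \<Rightarrow> real) \<Rightarrow> bool"
  where "C2_on S f \<longleftrightarrow> (\<exists>f' f''.
    (\<forall>x\<in>S. (f has_real_derivative f' x) (at x within S)) \<and>
    (\<forall>x\<in>S. (f' has_real_derivative f'' x) (at x within S)) \<and> continuous_on S f'')"

text \<open>
  The Lebesgue--Stieltjes integral of \<open>\<phi> (\<tau> / \<sigma>)\<close> with respect to \<open>d\<psi> (\<sigma>)\<close> over \<open>[1, \<tau>]\<close>. Continuing \<open>\<psi>\<close>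
  by the constant \<open>\<psi> 1\<close> to the left of \<open>1\<close> gives the distribution function on the whole line that
  \<^const>\<open>interval_measure\<close> expects, without affecting \<open>d\<psi>\<close> on \<open>(1, \<tau>]\<close>, and no mass at \<open>1\<close>.
  \<^const>\<open>interval_measure\<close> requires \<open>\<psi>\<close> to be nondecreasing and right-continuous.
\<close>

definition asymptotic_convolution ::
  "(real \<Rightarrow> real) \<Rightarrow> (real \<Rightarrow> real) \<Rightarrow> real \<Rightarrow> real"  (infixl "\<star>" 70)
  where "(\<phi> \<star> \<psi>) \<tau> = (LINT \<sigma>:{1..\<tau>}|interval_measure (\<lambda>\<sigma>. \<psi> (max 1 \<sigma>)). \<phi> (\<tau> / \<sigma>))"

end

theory Submission
  imports Defs
begin

text \<open>
  Choosing orthonormal eigenvectors of the positive eigenvalues of the factors, the products \<open>e \<otimes> f\<close> are a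
  complete system of eigenvectors of the tensor product, so its counting function counts the pairs of
  eigenvalues with product above \<open>t\<close>. With \<open>\<tau> = 1 / t\<close> this count and \<open>(\<phi> \<star> \<psi>) \<tau>\<close> are both
  convolutions of nondecreasing slowly varying functions, and both lie between sums of
  \<open>f (\<tau> / \<sigma>) * (g (2 * \<sigma>) - g \<sigma>)\<close> over \<open>\<sigma> = 2\<^sup>k\<close>, up to \<open>O(f + g)\<close>. Slow variation makes the upper
  and lower sums equivalent, summation by parts allows one to replace each of \<open>f\<close> and \<open>g\<close> by an
  equivalent function, and the error \<open>O(f + g)\<close> is negligible because \<open>f\<close> and \<open>g\<close> are unbounded.
\<close>

section \<open>Hilbert spaces over \<open>\<real>\<close> or \<open>\<complex>\<close>\<close>

text \<open>The obstacle is that \<open>f \<sim>[at_top] p\<close> controls values but not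
  increments: eigenvalue counts are step functions while \<open>\<phi>\<close> and
  \<open>\<psi>\<close> are continuous, so \<open>g\<close> cannot be exchanged for \<open>q\<close>
  where its increments occur. The increments have to sit on the factor that is not being replaced.
  Moreover, slow variation helps only at large arguments; the scales \<open>2 ^ k\<close> therefore
  stop at the \<open>n\<close> with \<open>\<tau> / 2 ^ n\<close> between \<open>M\<close> and
  \<open>2 * M\<close>, and the remaining range is paid for by the error term. That this term is
  small follows from the single product \<open>f (\<tau> / 2 ^ n) * (g (2 ^ n) - g 1)\<close>: for a
  fixed large \<open>n\<close> it is a large multiple of \<open>f \<tau>\<close>, and with
  \<open>\<tau> / 2 ^ n\<close> near a fixed large number it is a large multiple of
  \<open>g \<tau>\<close>. On the operator side, the tensor operator is given only by a definite
  description, so a bounded operator with the right values on elementary tensors must be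
  constructed; building it from its eigenvectors yields its complete list of positive eigenvalues at
  the same time.\<close>

lemma conjugate_0 [simp]: "conjugate 0 = (0 :: 'a::rc_field)"
  using conjugate_add[of "0::'a" 0] by simp

lemma mult_conjugate_of_real: "x * conjugate x = (of_real ((norm x)\<^sup>2) :: 'a::rc_field)"
  by (simp add: mult_conjugate of_real_def)

text \<open>The class axioms give only additivity and \<open>x * conjugate x\<close>; since the norm
  is multiplicative, both sides agree after multiplication by \<open>x * y\<close>, which cancels
  when nonzero.\<close>

lemma conjugate_mult: "conjugate (x * y) = conjugate x * (conjugate y :: 'a::rc_field)"
proof (cases "x * y = 0")
  case True
  then show ?thesis by auto
next
  case False
  have "(x * y) * conjugate (x * y) = (x * conjugate x) * (y * conjugate y)"
    by (simp add: mult_conjugate_of_real norm_mult power_mult_distrib)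
  also have "\<dots> = (x * y) * (conjugate x * conjugate y)" by (simp add: algebra_simps)
  finally show ?thesis using False by simp
qed

lemma conjugate_of_real [simp]: "conjugate (of_real r) = (of_real r :: 'a::rc_field)"
proof (cases "r = 0")
  case False
  have "of_real r * conjugate (of_real r) = (of_real r * of_real r :: 'a)"
    by (simp add: mult_conjugate_of_real power2_eq_square)
  then show ?thesis using False by simp
qed simp

lemma norm_conjugate [simp]: "norm (conjugate x) = norm (x :: 'a::rc_field)"
proof (cases "x = 0")
  case False
  have "norm x * norm (conjugate x) = norm x * norm x"
    by (metis mult_conjugate_of_real norm_mult norm_of_real abs_of_nonneg zero_le_power2
        power2_eq_square)
  then show ?thesis using False by simp
qed simp

context hilbert_space
begin

lemma ip_zero_left [simp]: "ip 0 x = 0"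
  using ip_add_left[of 0 0 x] by simp

lemma ip_zero_right [simp]: "ip x 0 = 0"
  using ip_commute[of x 0] by simp

lemma ip_add_right: "ip x (y + z) = ip x y + ip x z"
  using ip_commute[of "y + z" x] ip_commute[of y x] ip_commute[of z x]
  by (metis ip_commute ip_add_left conjugate_add)

lemma ip_scale_right: "ip x (scl c y) = conjugate c * ip x y"
  by (metis ip_commute ip_scale_left conjugate_mult)

lemma ip_diff_left: "ip (x - y) z = ip x z - ip y z"
  using ip_add_left[of "x - y" y z] by simp

lemma ip_diff_right: "ip x (y - z) = ip x y - ip x z"
  using ip_add_right[of x "y - z" z] by simp

lemma ip_sum_left: "ip (\<Sum>i\<in>I. f i) x = (\<Sum>i\<in>I. ip (f i) x)"
  by (induction I rule: infinite_finite_induct) (auto simp: ip_add_left)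

lemma ip_sum_right: "ip x (\<Sum>i\<in>I. f i) = (\<Sum>i\<in>I. ip x (f i))"
  by (induction I rule: infinite_finite_induct) (auto simp: ip_add_right)

lemma norm_eq_ip: "(norm x)\<^sup>2 = norm (ip x x)"
  by (simp add: ip_self del: of_real_power)

lemma norm_scl: "norm (scl c x) = norm c * norm x"
proof -
  have "(norm (scl c x))\<^sup>2 = (norm c * norm x)\<^sup>2"
    by (simp add: norm_eq_ip ip_scale_left ip_scale_right norm_mult power_mult_distrib)
       (simp add: power2_eq_square)
  then show ?thesis by (simp add: power2_eq_iff_nonneg)
qed

lemma pythagoras:
  assumes "ip x y = 0"
  shows "(norm (x + y))\<^sup>2 = (norm x)\<^sup>2 + (norm y)\<^sup>2"
proof -
  have "ip y x = 0" using assms ip_commute[of y x] by simp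
  then have "ip (x + y) (x + y) = ip x x + ip y y"
    by (simp add: ip_add_left ip_add_right assms)
  then have "(of_real ((norm (x + y))\<^sup>2) :: 'k) = of_real ((norm x)\<^sup>2 + (norm y)\<^sup>2)"
    by (simp add: ip_self)
  then show ?thesis by (simp only: of_real_eq_iff)
qed

lemma cauchy_schwarz: "norm (ip x y) \<le> norm x * norm y"
proof (cases "y = 0")
  case False
  \<comment> \<open>Coefficient of the projection of \<open>x\<close> onto the line of
    \<open>y\<close>; Pythagoras for \<open>x - scl c y\<close> and \<open>scl c y\<close> bounds
    the projection by \<open>norm x\<close>.\<close>
  define c where "c = ip x y / of_real ((norm y)\<^sup>2)"
  have "ip (x - scl c y) y = 0"
    using False by (simp add: ip_diff_left ip_scale_left c_def ip_self)
  then have "ip (x - scl c y) (scl c y) = 0" by (simp add: ip_scale_right)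
  from pythagoras[OF this] have "(norm (scl c y))\<^sup>2 \<le> (norm x)\<^sup>2" by simp
  then have "norm c * norm y \<le> norm x"
    by (simp add: norm_scl power2_le_iff_abs_le)
  moreover have "norm c * norm y = norm (ip x y) / norm y"
    using False by (simp add: c_def norm_divide norm_mult power2_eq_square)
  ultimately show ?thesis using False by (simp add: divide_le_eq)
qed simp

lemma scl_scaleR: "scl c (r *\<^sub>R x) = r *\<^sub>R scl c x"
  by (metis scale_of_real scale_scale mult.commute)

lemma bounded_linear_scl: "bounded_linear (scl c)"
  by (rule bounded_linear_intro[where K = "norm c"])
     (simp_all add: scale_right_distrib scl_scaleR norm_scl mult.commute)

lemma bounded_linear_ip_left: "bounded_linear (\<lambda>x. ip x y)"
proof (rule bounded_linear_intro[where K = "norm y"])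
  show "ip (r *\<^sub>R x) y = r *\<^sub>R ip x y" for r x
    by (metis scale_of_real ip_scale_left scaleR_conv_of_real)
qed (simp_all add: ip_add_left cauchy_schwarz)

section \<open>Finite orthonormal expansions and eigensystems\<close>

definition orthonormal :: "'a set \<Rightarrow> bool"
  where "orthonormal E \<longleftrightarrow> (\<forall>x\<in>E. \<forall>y\<in>E. ip x y = (if x = y then 1 else 0))"

lemma orthonormal_subset: "orthonormal E \<Longrightarrow> F \<subseteq> E \<Longrightarrow> orthonormal F"
  unfolding orthonormal_def by blast

lemma orthonormal_ip:
  "orthonormal E \<Longrightarrow> x \<in> E \<Longrightarrow> y \<in> E \<Longrightarrow> ip x y = (if x = y then 1 else 0)"
  by (auto simp: orthonormal_def)

lemma orthonormal_norm: "orthonormal E \<Longrightarrow> x \<in> E \<Longrightarrow> norm x = 1"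
proof -
  assume "orthonormal E" "x \<in> E"
  then have "(norm x)\<^sup>2 = 1" by (simp add: norm_eq_ip orthonormal_ip)
  then show ?thesis by (simp add: power2_eq_1_iff) (metis norm_ge_zero not_one_le_zero neg_0_le_iff_le)
qed

lemma ip_sum_orthonormal:
  assumes "orthonormal E" "finite E" "e \<in> E"
  shows "ip (\<Sum>x\<in>E. scl (c x) x) e = c e"
proof -
  have "ip (\<Sum>x\<in>E. scl (c x) x) e = (\<Sum>x\<in>E. if x = e then c x else 0)"
    unfolding ip_sum_left by (rule sum.cong) (auto simp: ip_scale_left orthonormal_ip[OF assms(1) _ assms(3)])
  then show ?thesis using assms by simp
qed

lemma norm_sum_orthonormal:
  assumes "orthonormal E" "finite E"
  shows "(norm (\<Sum>x\<in>E. scl (c x) x))\<^sup>2 = (\<Sum>x\<in>E. (norm (c x))\<^sup>2)"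
proof -
  have "ip (\<Sum>x\<in>E. scl (c x) x) (\<Sum>x\<in>E. scl (c x) x) = (\<Sum>x\<in>E. conjugate (c x) * c x)"
    unfolding ip_sum_right[of _ _ E]
    by (rule sum.cong) (auto simp: ip_scale_right ip_sum_orthonormal[OF assms])
  also have "\<dots> = of_real (\<Sum>x\<in>E. (norm (c x))\<^sup>2)"
    by (simp add: mult_conjugate_of_real mult.commute)
  finally have "(of_real ((norm (\<Sum>x\<in>E. scl (c x) x))\<^sup>2) :: 'k) = of_real (\<Sum>x\<in>E. (norm (c x))\<^sup>2)"
    by (simp add: ip_self)
  then show ?thesis by (simp only: of_real_eq_iff)
qed

lemma ip_residual_orthonormal:
  assumes "orthonormal E" "finite E" "e \<in> E"
  shows "ip (x - (\<Sum>e\<in>E. scl (ip x e) e)) e = 0"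
  using ip_sum_orthonormal[OF assms, of "ip x"] by (simp add: ip_diff_left)

lemma norm_residual_orthonormal:
  assumes "orthonormal E" "finite E"
  shows "(norm x)\<^sup>2 = (norm (x - (\<Sum>e\<in>E. scl (ip x e) e)))\<^sup>2 + (\<Sum>e\<in>E. (norm (ip x e))\<^sup>2)"
proof -
  let ?p = "\<Sum>e\<in>E. scl (ip x e) e"
  have "ip (x - ?p) ?p = 0"
    unfolding ip_sum_right[of _ _ E]
    by (rule sum.neutral) (auto simp: ip_scale_right ip_residual_orthonormal[OF assms])
  from pythagoras[OF this] show ?thesis by (simp add: norm_sum_orthonormal[OF assms])
qed

lemma bessel:
  assumes "orthonormal E" "finite E"
  shows "(\<Sum>e\<in>E. (norm (ip x e))\<^sup>2) \<le> (norm x)\<^sup>2"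
  using norm_residual_orthonormal[OF assms, of x] by simp

text \<open>Parseval on the left and Bessel on the right: a diagonal operator is bounded by its
  largest multiplier. This controls partial sums as well as tails of eigenvector expansions.\<close>

lemma norm_sum_orthonormal_le:
  assumes "orthonormal E" "finite E" "\<And>e. e \<in> E \<Longrightarrow> norm (c e) \<le> C" "C \<ge> 0"
  shows "norm (\<Sum>e\<in>E. scl (c e * ip x e) e) \<le> C * norm x"
proof -
  have "(norm (\<Sum>e\<in>E. scl (c e * ip x e) e))\<^sup>2 = (\<Sum>e\<in>E. (norm (c e))\<^sup>2 * (norm (ip x e))\<^sup>2)"
    by (simp add: norm_sum_orthonormal[OF assms(1,2)] norm_mult power_mult_distrib)
  also have "\<dots> \<le> (\<Sum>e\<in>E. C\<^sup>2 * (norm (ip x e))\<^sup>2)"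
    by (intro sum_mono mult_right_mono power_mono assms) auto
  also have "\<dots> \<le> C\<^sup>2 * (norm x)\<^sup>2"
    by (simp add: bessel[OF assms(1,2)] mult_left_mono flip: sum_distrib_left)
  finally show ?thesis
    using assms(4) by (simp add: power2_le_iff_abs_le flip: power_mult_distrib)
qed

lemma orthonormal_independent:
  assumes "orthonormal E"
  shows "independent E"
  unfolding dependent_explicit
proof safe
  fix S u v assume *: "finite S" "S \<subseteq> E" "(\<Sum>v\<in>S. scl (u v) v) = 0" "v \<in> S" "u v \<noteq> 0"
  have "u v = ip (\<Sum>v\<in>S. scl (u v) v) v"
    using ip_sum_orthonormal[OF orthonormal_subset[OF assms *(2)] *(1) *(4)] by simp
  then show False using * by simp
qed

text \<open>The eigenvalue of \<open>e\<close> is encoded as \<open>norm (T e)\<close>, so no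
  separate family of eigenvalues is carried along. The set \<open>E\<close> need not span the space,
  since the kernel is left out; the last clause is completeness for the positive
  eigenvalues.\<close>

definition eigensystem :: "('a \<Rightarrow> 'a) \<Rightarrow> 'a set \<Rightarrow> bool"
  where "eigensystem T E \<longleftrightarrow> orthonormal E
    \<and> (\<forall>e\<in>E. T e \<noteq> 0 \<and> T e = scl (of_real (norm (T e))) e)
    \<and> (\<forall>t>0. finite {e \<in> E. norm (T e) > t})
    \<and> (\<forall>\<mu>>0. eigenspace scl T \<mu> \<subseteq> span {e \<in> E. norm (T e) = \<mu>})"

lemma dim_eigenspace:
  assumes "eigensystem T E" "Vector_Spaces.linear scl scl T" "\<mu> > 0"
  shows "dim (eigenspace scl T \<mu>) = card {e \<in> E. norm (T e) = \<mu>}"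
proof -
  interpret T: Vector_Spaces.linear scl scl T by fact
  let ?E = "{e \<in> E. norm (T e) = \<mu>}"
  have "subspace (eigenspace scl T \<mu>)"
    by (rule subspaceI)
       (auto simp: eigenspace_def T.zero T.add T.scale scale_right_distrib scale_left_commute)
  moreover have "?E \<subseteq> eigenspace scl T \<mu>"
    using assms(1) by (auto simp: eigensystem_def eigenspace_def)
  ultimately have "span ?E = span (eigenspace scl T \<mu>)"
    using assms(1,3) by (metis (no_types, lifting) eigensystem_def span_minimal span_eq_iff subset_antisym)
  moreover have "independent ?E"
    using assms(1) orthonormal_independent[OF orthonormal_subset, of E ?E]
    by (simp add: eigensystem_def)
  ultimately show ?thesis by (rule dim_eq_card)
qed

text \<open>The index set is fibred over the eigenvalues above \<open>t\<close>; the fibre over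
  \<open>\<mu>\<close> has as many indices as there are vectors of \<open>E\<close> with that
  eigenvalue, and summing over the fibres counts every vector once.\<close>

lemma counting_function_eigensystem:
  assumes "eigensystem T E" "Vector_Spaces.linear scl scl T" "t > 0"
  shows "counting_function scl t T = card {e \<in> E. norm (T e) > t}"
proof -
  let ?E = "{e \<in> E. norm (T e) > t}"
  let ?M = "(\<lambda>e. norm (T e)) ` ?E"
  have fin: "finite ?E" using assms by (auto simp: eigensystem_def)
  have card0: "{e \<in> E. norm (T e) = \<mu>} = {e \<in> ?E. norm (T e) = \<mu>}" if "\<mu> > t" for \<mu>
    using that by auto
  have "{n \<in> eigenvalue_indices scl T. fst n > t}
      = Sigma ?M (\<lambda>\<mu>. {..<card {e \<in> ?E. norm (T e) = \<mu>}})" (is "?L = ?R")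
  proof (intro equalityI subsetI)
    fix p assume "p \<in> ?L"
    then obtain \<mu> k where p: "p = (\<mu>, k)" "\<mu> > t" "k < dim (eigenspace scl T \<mu>)" "\<mu> > 0"
      by (auto simp: eigenvalue_indices_def)
    then have k: "k < card {e \<in> ?E. norm (T e) = \<mu>}"
      using dim_eigenspace[OF assms(1,2)] card0[OF p(2)] by simp
    then have "{e \<in> ?E. norm (T e) = \<mu>} \<noteq> {}" by (metis card.empty not_less0)
    then show "p \<in> ?R" using p k by auto
  next
    fix p assume "p \<in> ?R"
    then obtain \<mu> k where p: "p = (\<mu>, k)" "\<mu> > t" "k < card {e \<in> ?E. norm (T e) = \<mu>}"
      by auto
    then show "p \<in> ?L"
      using dim_eigenspace[OF assms(1,2), of \<mu>] card0[OF p(2)] assms(3)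
      by (auto simp: eigenvalue_indices_def)
  qed
  then have "counting_function scl t T = (\<Sum>\<mu>\<in>?M. card {e \<in> ?E. norm (T e) = \<mu>})"
    using fin by (simp add: counting_function_def)
  also have "\<dots> = card ?E"
    using sum.image_gen[OF fin, of "\<lambda>_. 1::nat" "\<lambda>e. norm (T e)"] by simp
  finally show ?thesis .
qed

end

section \<open>The spectral theorem for compact nonnegative operators\<close>

context hilbert_space
begin

text \<open>Continuity is not part of \<open>compact_operator\<close> but follows from it: a compact
  closure makes the image of the unit ball bounded.\<close>

lemma compact_operator_bounded_linear:
  assumes "compact_operator scl T"
  shows "bounded_linear T"
proof -
  interpret T: Vector_Spaces.linear scl scl T using assms by (simp add: compact_operator_def)
  have scaleR: "T (r *\<^sub>R x) = r *\<^sub>R T x" for r x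
    by (metis T.scale scale_of_real)
  have "compact (closure (T ` cball 0 1))" using assms by (simp add: compact_operator_def)
  then have "bounded (T ` cball 0 1)"
    by (intro bounded_subset[OF compact_imp_bounded closure_subset])
  then obtain K where K: "norm (T x) \<le> K" if "norm x \<le> 1" for x
    unfolding bounded_iff by fastforce
  have "norm (T x) \<le> norm x * K" for x
  proof (cases "x = 0")
    case False
    have "norm (T ((1 / norm x) *\<^sub>R x)) \<le> K" using False by (intro K) simp
    then show ?thesis using False by (simp add: scaleR field_simps)
  qed (simp add: T.zero)
  then show ?thesis by (rule bounded_linear_intro[OF T.add scaleR])
qed

lemma subspace_scaleR: "subspace V \<Longrightarrow> x \<in> V \<Longrightarrow> r *\<^sub>R x \<in> V"
  by (metis scale_of_real subspace_scale)

text \<open>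
  If the norm \<open>m\<close> of \<open>T\<close> on \<open>V\<close> is attained in the limit along unit vectors \<open>y\<^sub>n\<close>, then
  \<open>T\<^sup>2 y\<^sub>n - m\<^sup>2 y\<^sub>n \<rightarrow> 0\<close>; compactness yields \<open>v\<close> with \<open>T\<^sup>2 v = m\<^sup>2 v\<close>, and \<open>T v + m v\<close> is the eigenvector.
\<close>

lemma eigenvector_exists:
  assumes cpt: "compact_operator scl T" and sa: "self_adjoint ip T" and nn: "nonneg_operator ip T"
    and V: "closed V" "subspace V" "T ` V \<subseteq> V"
    and x0: "x0 \<in> V" "t * norm x0 < norm (T x0)" and t: "0 \<le> t"
  obtains u m where "u \<in> V" "u \<noteq> 0" "m > t" "T u = scl (of_real m) u"
proof -
  interpret T: Vector_Spaces.linear scl scl T using cpt by (simp add: compact_operator_def)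
  interpret bT: bounded_linear T by (rule compact_operator_bounded_linear[OF cpt])
  have VR: "r *\<^sub>R x \<in> V" if "x \<in> V" for r x using subspace_scaleR[OF V(2) that] .
  obtain K where K: "norm (T x) \<le> norm x * K" for x using bT.bounded by blast
  \<comment> \<open>The ball rather than the sphere: it contains 0, so nonemptiness of the range of
    the supremum is immediate, and homogeneity still gives \<open>m_bound\<close>.\<close>
  define U where "U = {x \<in> V. norm x \<le> 1}"
  define m where "m = (SUP x\<in>U. norm (T x))"
  have bdd: "bdd_above ((\<lambda>x. norm (T x)) ` U)"
  proof (rule bdd_aboveI2)
    fix x assume "x \<in> U"
    have "norm (T x) \<le> norm x * \<bar>K\<bar>" using K[of x] by (smt (verit) mult_left_mono norm_ge_zero)
    also have "\<dots> \<le> 1 * \<bar>K\<bar>" using \<open>x \<in> U\<close> by (intro mult_right_mono) (auto simp: U_def)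
    finally show "norm (T x) \<le> \<bar>K\<bar>" by simp
  qed
  have "0 \<in> U" using V(2) by (auto simp: U_def subspace_0)
  have m_ge: "norm (T x) \<le> m" if "x \<in> U" for x
    unfolding m_def by (rule cSUP_upper[OF that bdd])
  have m_bound: "norm (T x) \<le> m * norm x" if "x \<in> V" for x
  proof (cases "x = 0")
    case False
    have "(1 / norm x) *\<^sub>R x \<in> U" using False that VR by (auto simp: U_def)
    from m_ge[OF this] show ?thesis using False by (simp add: bT.scaleR field_simps)
  qed (simp add: bT.zero)
  have "t * norm x0 < m * norm x0" using x0 m_bound[of x0] by simp
  then have m: "t < m" by (simp add: mult_less_cancel_right)
  have "\<exists>x\<in>U. m - 1 / real (Suc n) < norm (T x)" for n
    using less_cSUP_iff[OF _ bdd, of "m - 1 / real (Suc n)"] \<open>0 \<in> U\<close> by (auto simp: m_def)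
  then obtain x where x: "\<And>n. x n \<in> U" "\<And>n. m - 1 / real (Suc n) < norm (T (x n))" by metis
  have "(\<lambda>n. norm (T (x n))) \<longlonglongrightarrow> m"
  proof (rule tendsto_sandwich)
    show "(\<lambda>n. m - 1 / real (Suc n)) \<longlonglongrightarrow> m"
      using tendsto_diff[OF tendsto_const LIMSEQ_inverse_real_of_nat, of m] by (simp add: inverse_eq_divide)
    show "\<forall>\<^sub>F n in sequentially. m - 1 / real (Suc n) \<le> norm (T (x n))"
      using x(2) by (intro always_eventually allI less_imp_le)
    show "\<forall>\<^sub>F n in sequentially. norm (T (x n)) \<le> m"
      using x(1) m_ge by (intro always_eventually) blast
  qed simp
  moreover have "compact (closure (T ` cball 0 1))"
    using cpt by (simp add: compact_operator_def)
  moreover have "T (x n) \<in> closure (T ` cball 0 1)" for n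
    using x(1)[of n] closure_subset by (force simp: U_def)
  ultimately obtain l r where r: "strict_mono r" and l: "((\<lambda>n. T (x n)) \<circ> r) \<longlonglongrightarrow> l"
    unfolding compact_def by metis
  define y where "y = x \<circ> r"
  have yU: "y n \<in> U" for n using x(1) by (simp add: y_def)
  have Ty: "(\<lambda>n. T (y n)) \<longlonglongrightarrow> l" using l by (simp add: y_def o_def)
  have nTy: "(\<lambda>n. norm (T (y n))) \<longlonglongrightarrow> m"
    using LIMSEQ_subseq_LIMSEQ[OF \<open>(\<lambda>n. norm (T (x n))) \<longlonglongrightarrow> m\<close> r] by (simp add: y_def o_def)
  have nl: "norm l = m" using LIMSEQ_unique[OF tendsto_norm[OF Ty] nTy] .
  have TTy: "(\<lambda>n. T (T (y n))) \<longlonglongrightarrow> T l" by (rule bT.tendsto[OF Ty])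
  have "l \<in> V"
    using closed_sequentially[OF V(1) _ Ty] yU V(3) by (auto simp: U_def)
  \<comment> \<open>Expanding the square, self-adjointness turns both mixed terms into
    \<open>(norm (T z))\<^sup>2\<close>, and \<open>m_bound\<close> applies to \<open>T z\<close>
    because \<open>V\<close> is invariant. The right side tends to 0 along the maximizing
    sequence.\<close>
  have key: "(norm (T (T z) - m\<^sup>2 *\<^sub>R z))\<^sup>2 \<le> m ^ 4 - m\<^sup>2 * (norm (T z))\<^sup>2" if "z \<in> U" for z
  proof -
    let ?r = "of_real (m\<^sup>2) :: 'k"
    have 1: "ip (T (T z)) z = of_real ((norm (T z))\<^sup>2)" "ip z (T (T z)) = of_real ((norm (T z))\<^sup>2)"
      using sa ip_self[of "T z"] unfolding self_adjoint_def by metis+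
    have "ip (T (T z) - scl ?r z) (T (T z) - scl ?r z)
        = ip (T (T z)) (T (T z)) - ?r * ip (T (T z)) z - ?r * ip z (T (T z)) + ?r * ?r * ip z z"
      by (simp add: ip_diff_left ip_diff_right ip_scale_left ip_scale_right algebra_simps
            del: of_real_power)
    also have "\<dots> = of_real ((norm (T (T z)))\<^sup>2 - 2 * m\<^sup>2 * (norm (T z))\<^sup>2 + m ^ 4 * (norm z)\<^sup>2)"
      unfolding 1 ip_self by (simp add: power2_eq_square power4_eq_xxxx algebra_simps)
    finally have "(norm (T (T z) - scl ?r z))\<^sup>2
        = (norm (T (T z)))\<^sup>2 - 2 * m\<^sup>2 * (norm (T z))\<^sup>2 + m ^ 4 * (norm z)\<^sup>2"
      unfolding ip_self of_real_eq_iff .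
    moreover have "(norm (T (T z)))\<^sup>2 \<le> m\<^sup>2 * (norm (T z))\<^sup>2"
      using power_mono[OF m_bound[of "T z"], of 2] that V(3) by (auto simp: U_def power_mult_distrib)
    moreover have "m ^ 4 * (norm z)\<^sup>2 \<le> m ^ 4 * 1"
      using that by (intro mult_left_mono) (auto simp: U_def power_le_one)
    ultimately show ?thesis by (simp only: scale_of_real)
  qed
  have "(\<lambda>n. T (T (y n)) - m\<^sup>2 *\<^sub>R y n) \<longlonglongrightarrow> 0"
  proof -
    have "(\<lambda>n. m ^ 4 - m\<^sup>2 * (norm (T (y n)))\<^sup>2) \<longlonglongrightarrow> m ^ 4 - m\<^sup>2 * m\<^sup>2"
      by (intro tendsto_intros nTy)
    then have "(\<lambda>n. m ^ 4 - m\<^sup>2 * (norm (T (y n)))\<^sup>2) \<longlonglongrightarrow> 0"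
      by (simp add: power2_eq_square power4_eq_xxxx)
    then have "(\<lambda>n. (norm (T (T (y n)) - m\<^sup>2 *\<^sub>R y n))\<^sup>2) \<longlonglongrightarrow> 0"
      by (rule Lim_null_comparison[rotated]) (simp add: key yU)
    then have "(\<lambda>n. norm (T (T (y n)) - m\<^sup>2 *\<^sub>R y n)) \<longlonglongrightarrow> 0"
      using tendsto_real_sqrt by fastforce
    then show ?thesis by (rule tendsto_norm_zero_cancel)
  qed
  \<comment> \<open>Compactness made only \<open>T (y n)\<close> converge. Now \<open>y n\<close>
    converges too, since \<open>m\<^sup>2 *\<^sub>R y n\<close> is a difference of two convergent
    sequences and \<open>m\<close> is positive.\<close>
  from tendsto_diff[OF TTy this] have "(\<lambda>n. m\<^sup>2 *\<^sub>R y n) \<longlonglongrightarrow> T l" by simp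
  from tendsto_scaleR[OF tendsto_const this, of "1 / m\<^sup>2"]
  have yv: "y \<longlonglongrightarrow> (1 / m\<^sup>2) *\<^sub>R T l" using m t by simp
  define v where "v = (1 / m\<^sup>2) *\<^sub>R T l"
  have Tv: "T v = l" using LIMSEQ_unique[OF bT.tendsto[OF yv] Ty] by (simp add: v_def)
  have TTv: "T (T v) = m\<^sup>2 *\<^sub>R v" unfolding Tv using m t by (simp add: v_def)
  have "v \<in> V" unfolding v_def using VR \<open>l \<in> V\<close> V(3) by blast
  define u where "u = T v + m *\<^sub>R v"
  have "u \<in> V" unfolding u_def using V \<open>v \<in> V\<close> VR by (auto intro: subspace_add)
  moreover have "T u = scl (of_real m) u"
    by (simp add: u_def bT.add bT.scaleR TTv scale_of_real scaleR_add_right power2_eq_square add.commute)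
  \<comment> \<open>Otherwise \<open>v\<close> would be an eigenvector for \<open>-m\<close>,
    against nonnegativity; \<open>v\<close> is nonzero because \<open>T v = l\<close> has norm
    \<open>m\<close>.\<close>
  moreover have "u \<noteq> 0"
  proof
    assume "u = 0"
    then have "T v = scl (of_real (- m)) v" unfolding scale_of_real by (simp add: u_def eq_neg_iff_add_eq_0)
    then have "ip (T v) v = of_real (- m * (norm v)\<^sup>2)" by (simp only: ip_scale_left ip_self of_real_mult)
    then have "0 \<le> - m * (norm v)\<^sup>2"
      using nn by (metis nonneg_operator_def nonneg_Reals_of_real_iff)
    moreover have "v \<noteq> 0" using Tv nl m t bT.zero by auto
    ultimately show False using m t by (simp add: mult_le_0_iff zero_le_mult_iff)
  qed
  ultimately show ?thesis using that m by blast
qed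

lemma eigenvectors_orthogonal:
  assumes "self_adjoint ip T" "T x = scl (of_real a) x" "T y = scl (of_real b) y" "a \<noteq> b"
  shows "ip x y = 0"
proof -
  have "of_real a * ip x y = of_real b * ip x y"
    using assms(1) unfolding self_adjoint_def
    by (metis assms(2,3) ip_scale_left ip_scale_right conjugate_of_real)
  then show ?thesis using assms(4) by simp
qed

text \<open>Zorn's lemma provides a maximal orthonormal set of eigenvectors with positive
  eigenvalues. If the part of \<open>T\<close> left after splitting off the eigenvalues above
  \<open>t\<close> had norm above \<open>t\<close>, \<open>eigenvector_exists\<close> would produce
  an eigenvector contradicting maximality. The resulting error bound for truncated expansions is
  what later identifies the tensor operator.\<close>

lemma eigensystem_exists:
  assumes cpt: "compact_operator scl T" and sa: "self_adjoint ip T" and nn: "nonneg_operator ip T"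
  obtains E where "eigensystem T E"
    "\<And>t x. t > 0 \<Longrightarrow> norm (T x - (\<Sum>e | e \<in> E \<and> norm (T e) > t. scl (ip x e) (T e))) \<le> t * norm x"
proof -
  interpret T: Vector_Spaces.linear scl scl T using cpt by (simp add: compact_operator_def)
  interpret bT: bounded_linear T by (rule compact_operator_bounded_linear[OF cpt])
  define ons where "ons = {E. orthonormal E \<and> (\<forall>e\<in>E. T e \<noteq> 0 \<and> T e = scl (of_real (norm (T e))) e)}"
  have "\<Union>C \<in> ons" if C: "subset.chain ons C" for C
  proof -
    have "orthonormal (\<Union>C)"
      unfolding orthonormal_def
    proof (intro ballI)
      fix x y assume "x \<in> \<Union>C" "y \<in> \<Union>C"
      then obtain X Y where XY: "x \<in> X" "y \<in> Y" "X \<in> C" "Y \<in> C" by blast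
      then have "X \<subseteq> Y \<or> Y \<subseteq> X" using C by (auto simp: subset.chain_def)
      then obtain Z where "Z \<in> C" "x \<in> Z" "y \<in> Z" using XY by blast
      moreover have "orthonormal Z" using C \<open>Z \<in> C\<close> by (auto simp: subset.chain_def ons_def)
      ultimately show "ip x y = (if x = y then 1 else 0)" by (simp add: orthonormal_ip)
    qed
    then show ?thesis using C by (auto simp: subset.chain_def ons_def)
  qed
  from subset_Zorn'[OF this] obtain E
    where "E \<in> ons" and max: "\<And>X. X \<in> ons \<Longrightarrow> E \<subseteq> X \<Longrightarrow> X = E"
    by blast
  then have on: "orthonormal E" and eig: "\<And>e. e \<in> E \<Longrightarrow> T e \<noteq> 0"
      "\<And>e. e \<in> E \<Longrightarrow> T e = scl (of_real (norm (T e))) e"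
    unfolding ons_def by blast+
  \<comment> \<open>Maximality in usable form: a nonzero eigenvector of positive eigenvalue
    orthogonal to \<open>E\<close> could be normalised and adjoined.\<close>
  have complete: "u = 0" if u: "T u = scl (of_real m) u" "m > 0" "\<And>e. e \<in> E \<Longrightarrow> ip u e = 0" for u m
  proof (rule ccontr)
    assume "u \<noteq> 0"
    define w where "w = scl (of_real (1 / norm u)) u"
    have w: "norm w = 1" using \<open>u \<noteq> 0\<close> by (simp add: w_def norm_scl norm_divide)
    have Tw: "T w = scl (of_real m) w" by (simp add: w_def T.scale u scale_left_commute)
    then have nTw: "norm (T w) = m" using w u(2) by (simp add: norm_scl)
    have "ip w w = 1" by (simp add: ip_self w)
    have we: "ip w e = 0" "ip e w = 0" if "e \<in> E" for e
      using u(3)[OF that] ip_commute[of e w] by (auto simp: w_def ip_scale_left)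
    have "orthonormal (insert w E)"
      using on we \<open>ip w w = 1\<close> by (auto simp: orthonormal_def)
    moreover have "T w \<noteq> 0" "T w = scl (of_real (norm (T w))) w"
      using u(2) Tw nTw by (fastforce, simp only: nTw)
    ultimately have "insert w E \<in> ons" unfolding ons_def using eig by blast
    then have "w \<in> E" using max[of "insert w E"] by blast
    then show False using we \<open>ip w w = 1\<close> by simp
  qed
  \<comment> \<open>Infinitely many such vectors would have images at mutual distance more than
    \<open>t\<close>, by Pythagoras, and no subsequence of these images could converge.\<close>
  have fin: "finite {e \<in> E. norm (T e) > t}" if "t > 0" for t
  proof (rule ccontr)
    assume "infinite {e \<in> E. norm (T e) > t}"
    then obtain s :: "nat \<Rightarrow> 'a" where s: "inj s" "range s \<subseteq> {e \<in> E. norm (T e) > t}"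
      using infinite_countable_subset by blast
    then have sE: "s n \<in> E" "norm (T (s n)) > t" for n by auto
    have "compact (closure (T ` cball 0 1))" using cpt by (simp add: compact_operator_def)
    moreover have "T (s n) \<in> closure (T ` cball 0 1)" for n
      using orthonormal_norm[OF on sE(1)[of n]] closure_subset by (force simp: image_iff)
    ultimately obtain l r where r: "strict_mono r" and l: "((\<lambda>n. T (s n)) \<circ> r) \<longlonglongrightarrow> l"
      unfolding compact_def by metis
    have "\<exists>N. \<forall>i\<ge>N. \<forall>j\<ge>N. norm (T (s (r i)) - T (s (r j))) < t"
      using LIMSEQ_imp_Cauchy[OF l] \<open>t > 0\<close> by (simp add: Cauchy_iff o_def)
    then obtain N where N: "\<And>i j. i \<ge> N \<Longrightarrow> j \<ge> N \<Longrightarrow> norm (T (s (r i)) - T (s (r j))) < t"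
      by blast
    let ?a = "s (r N)" and ?b = "s (r (Suc N))"
    have "?a \<noteq> ?b" using s(1) r by (metis inj_eq strict_mono_eq n_not_Suc_n)
    then have ab: "ip ?a ?b = 0" using orthonormal_ip[OF on sE(1) sE(1)] by simp
    have "ip (T ?a) (T ?b) = ip (scl (of_real (norm (T ?a))) ?a) (scl (of_real (norm (T ?b))) ?b)"
      by (rule arg_cong2[OF eig(2)[OF sE(1)] eig(2)[OF sE(1)]])
    then have "ip (T ?a) (- T ?b) = 0"
      using ab ip_diff_right[of "T ?a" 0 "T ?b"] by (simp add: ip_scale_left ip_scale_right)
    from pythagoras[OF this] have "(norm (T ?a - T ?b))\<^sup>2 \<ge> (norm (T ?a))\<^sup>2" by simp
    then have "norm (T ?a) \<le> norm (T ?a - T ?b)" by (simp add: power2_le_iff_abs_le)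
    then show False using N[of N "Suc N"] sE(2)[of "r N"] by simp
  qed
  have "eigensystem T E"
    unfolding eigensystem_def
  proof (intro conjI ballI allI impI subsetI)
    show "orthonormal E" by (rule on)
    show "T e \<noteq> 0" "T e = scl (of_real (norm (T e))) e" if "e \<in> E" for e
      using that by (rule eig)+
    show "finite {e \<in> E. norm (T e) > t}" if "t > 0" for t using that by (rule fin)
    fix \<mu> :: real and v assume \<mu>: "\<mu> > 0" and v: "v \<in> eigenspace scl T \<mu>"
    let ?F = "{e \<in> E. norm (T e) = \<mu>}"
    \<comment> \<open>\<open>fin\<close> counts eigenvalues strictly above its threshold, hence
      \<open>\<mu> / 2\<close> instead of \<open>\<mu>\<close>.\<close>
    have finF: "finite ?F" by (rule finite_subset[OF _ fin[of "\<mu> / 2"]]) (use \<mu> in auto)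
    have onF: "orthonormal ?F" by (rule orthonormal_subset[OF on]) auto
    define w where "w = v - (\<Sum>e\<in>?F. scl (ip v e) e)"
    have "T e = scl (of_real \<mu>) e" if "e \<in> ?F" for e
    proof -
      have "norm (T e) = \<mu>" using that by simp
      from eig(2)[of e, unfolded this] that show ?thesis by blast
    qed
    then have "T (\<Sum>e\<in>?F. scl (ip v e) e) = (\<Sum>e\<in>?F. scl (ip v e) (scl (of_real \<mu>) e))"
      unfolding T.sum T.scale by (intro sum.cong) (simp_all del: scale_scale)
    also have "\<dots> = scl (of_real \<mu>) (\<Sum>e\<in>?F. scl (ip v e) e)"
      by (simp add: scale_sum_right scale_left_commute mult.commute)
    finally have Tw: "T w = scl (of_real \<mu>) w"
      using v by (simp add: w_def T.diff eigenspace_def scale_right_diff_distrib)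
    \<comment> \<open>The residual \<open>w\<close> is still in the eigenspace of
      \<open>\<mu>\<close>: it is orthogonal to \<open>?F\<close> by construction and to the rest of
      \<open>E\<close> because the eigenvalues differ.\<close>
    have "ip w e = 0" if "e \<in> E" for e
    proof (cases "norm (T e) = \<mu>")
      case True
      then show ?thesis using ip_residual_orthonormal[OF onF finF, of e v] that by (simp add: w_def)
    next
      case False
      then show ?thesis using eigenvectors_orthogonal[OF sa Tw eig(2)[OF that]] by simp
    qed
    then have "w = 0" using complete[OF Tw \<mu>] by blast
    then have "v = (\<Sum>e\<in>?F. scl (ip v e) e)" by (simp add: w_def)
    also have "\<dots> \<in> span ?F" by (intro span_sum span_scale span_base)
    finally show "v \<in> span ?F" .
  qed
  moreover have "norm (T x - (\<Sum>e | e \<in> E \<and> norm (T e) > t. scl (ip x e) (T e))) \<le> t * norm x"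
    if t: "t > 0" for t x
  proof -
    let ?F = "{e. e \<in> E \<and> norm (T e) > t}"
    define V where "V = {x. \<forall>e\<in>?F. ip x e = 0}"
    have onF: "orthonormal ?F" by (rule orthonormal_subset[OF on]) auto
    have clV: "closed V"
    proof -
      have "V = (\<Inter>e\<in>?F. {x. ip x e = 0})" by (auto simp: V_def)
      moreover have "closed {x. ip x e = 0}" for e
        by (intro closed_Collect_eq continuous_intros linear_continuous_on bounded_linear_ip_left)
      ultimately show ?thesis by auto
    qed
    have subV: "subspace V"
      by (rule subspaceI) (auto simp: V_def ip_add_left ip_scale_left)
    have invV: "T ` V \<subseteq> V"
    proof clarify
      fix x assume x: "x \<in> V"
      have "ip (T x) e = 0" if "e \<in> ?F" for e
      proof -
        have "ip (T x) e = ip x (T e)" using sa by (simp add: self_adjoint_def)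
        also have "\<dots> = ip x (scl (of_real (norm (T e))) e)"
          using that by (intro arg_cong[OF eig(2)]) simp
        also have "\<dots> = of_real (norm (T e)) * ip x e" by (simp add: ip_scale_right)
        finally show ?thesis using x that by (simp add: V_def)
      qed
      then show "T x \<in> V" by (simp add: V_def)
    qed
    \<comment> \<open>An eigenvector \<open>u\<close> in \<open>V\<close> with eigenvalue above
      \<open>t\<close> is orthogonal to all of \<open>E\<close>: to \<open>?F\<close> by the choice
      of \<open>V\<close>, to the others because their eigenvalues are at most
      \<open>t\<close>.\<close>
    have small: "norm (T z) \<le> t * norm z" if z: "z \<in> V" for z
    proof (rule ccontr)
      assume "\<not> norm (T z) \<le> t * norm z"
      then have lt: "t * norm z < norm (T z)" by simp
      obtain u m where u: "u \<in> V" "u \<noteq> 0" "m > t" "T u = scl (of_real m) u"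
        using eigenvector_exists[OF cpt sa nn clV subV invV z lt less_imp_le[OF t]] by blast
      have "ip u e = 0" if "e \<in> E" for e
      proof (cases "norm (T e) > t")
        case True
        then show ?thesis using u(1) that by (simp add: V_def)
      next
        case False
        then show ?thesis using eigenvectors_orthogonal[OF sa u(4) eig(2)[OF that]] u(3) by simp
      qed
      then show False using complete[OF u(4)] u t by auto
    qed
    let ?z = "x - (\<Sum>e\<in>?F. scl (ip x e) e)"
    have "?z \<in> V" using ip_residual_orthonormal[OF onF fin[OF t]] by (simp add: V_def)
    moreover have "norm ?z \<le> norm x"
      using norm_residual_orthonormal[OF onF fin[OF t], of x] sum_nonneg[of ?F "\<lambda>e. (norm (ip x e))\<^sup>2"]
      by (intro power2_le_imp_le[of "norm ?z"]) auto
    ultimately have "norm (T ?z) \<le> t * norm x"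
      using small[of ?z] t by (meson mult_left_mono less_imp_le order_trans)
    then show ?thesis by (simp add: T.diff T.sum T.scale)
  qed
  ultimately show ?thesis by (rule that)
qed

end

section \<open>Tensor products\<close>

context hilbert_space
begin

text \<open>The operator with eigenvalues \<open>c\<close> on \<open>W\<close> and zero on the
  orthogonal complement is the limit of its finite truncations. The tail bound by a null sequence
  makes the truncations Cauchy and also keeps the eigenvalues above any positive level finite in
  number. The sets \<open>U n\<close> are left free so that they can be chosen to suit a product
  structure.\<close>

lemma diagonal_operator:
  fixes U :: "nat \<Rightarrow> 'a set" and c :: "'a \<Rightarrow> real"
  defines "W \<equiv> \<Union>n. U n"
  assumes on: "orthonormal W" and fin: "\<And>n. finite (U n)" and mono: "incseq U"
    and pos: "\<And>u. u \<in> W \<Longrightarrow> 0 < c u" and bound: "\<And>u. u \<in> W \<Longrightarrow> c u \<le> C"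
    and tail: "\<And>n u. u \<in> W - U n \<Longrightarrow> c u \<le> \<epsilon> n" and \<epsilon>: "\<epsilon> \<longlonglongrightarrow> 0"
  obtains S where "Vector_Spaces.linear scl scl S" "bounded_linear S"
    "\<And>z. (\<lambda>n. \<Sum>u\<in>U n. scl (of_real (c u) * ip z u) u) \<longlonglongrightarrow> S z"
    "\<And>u. u \<in> W \<Longrightarrow> norm (S u) = c u" "eigensystem S W"
proof -
  define P where "P n z = (\<Sum>u\<in>U n. scl (of_real (c u) * ip z u) u)" for n z
  have UW: "U n \<subseteq> W" for n by (auto simp: W_def)
  have onU: "orthonormal V" if "V \<subseteq> U n" for V n
    by (rule orthonormal_subset[OF on order_trans[OF that UW]])
  have P_bound: "norm (P n z) \<le> \<bar>C\<bar> * norm z" for n z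
    unfolding P_def
  proof (rule norm_sum_orthonormal_le[OF onU[OF order_refl] fin])
    show "norm (of_real (c u) :: 'k) \<le> \<bar>C\<bar>" if "u \<in> U n" for u
      using pos[of u] bound[of u] that UW[of n] by fastforce
  qed simp
  \<comment> \<open>Only vectors outside \<open>U n\<close> survive in the difference, and there
    \<open>c\<close> is at most \<open>\<epsilon> n\<close>.\<close>
  have P_diff: "norm (P m z - P n z) \<le> \<bar>\<epsilon> n\<bar> * norm z" if "n \<le> m" for m n z
  proof -
    have sub: "U n \<subseteq> U m" using mono that by (auto simp: incseq_def)
    then have "P m z - P n z = (\<Sum>u\<in>U m - U n. scl (of_real (c u) * ip z u) u)"
      unfolding P_def by (simp add: sum_diff[OF fin])
    also have "norm \<dots> \<le> \<bar>\<epsilon> n\<bar> * norm z"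
    proof (rule norm_sum_orthonormal_le[OF onU[of _ m]])
      show "norm (of_real (c u) :: 'k) \<le> \<bar>\<epsilon> n\<bar>" if "u \<in> U m - U n" for u
        using pos[of u] tail[of u n] that UW[of m] by fastforce
    qed (use fin in auto)
    finally show ?thesis .
  qed
  have "convergent (\<lambda>n. P n z)" for z
  proof (rule Cauchy_convergent, rule CauchyI')
    fix e :: real assume "e > 0"
    have "(\<lambda>n. \<bar>\<epsilon> n\<bar> * norm z) \<longlonglongrightarrow> \<bar>0\<bar> * norm z" by (intro tendsto_intros \<epsilon>)
    then have "eventually (\<lambda>n. \<bar>\<epsilon> n\<bar> * norm z < e) sequentially"
      by (rule order_tendstoD(2)) (use \<open>e > 0\<close> in simp)
    then obtain M where M: "\<And>n. n \<ge> M \<Longrightarrow> \<bar>\<epsilon> n\<bar> * norm z < e"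
      by (auto simp: eventually_sequentially)
    have "dist (P m z) (P n z) < e" if "m \<ge> M" "n > m" for m n
      using P_diff[of m n z] M[OF that(1)] that(2) by (simp add: dist_norm norm_minus_commute)
    then show "\<exists>M. \<forall>m\<ge>M. \<forall>n>m. dist (P m z) (P n z) < e" by blast
  qed
  then obtain S where S: "\<And>z. (\<lambda>n. P n z) \<longlonglongrightarrow> S z" unfolding convergent_def by metis
  have add: "S (x + y) = S x + S y" for x y
  proof (rule LIMSEQ_unique[OF S])
    have "P n (x + y) = P n x + P n y" for n
      by (simp add: P_def ip_add_left distrib_left scale_left_distrib sum.distrib)
    then show "(\<lambda>n. P n (x + y)) \<longlonglongrightarrow> S x + S y" using tendsto_add[OF S S] by simp
  qed
  have scale: "S (scl a x) = scl a (S x)" for a x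
  proof (rule LIMSEQ_unique[OF S])
    have "P n (scl a x) = scl a (P n x)" for n
      by (simp add: P_def ip_scale_left scale_sum_right mult.left_commute)
    then show "(\<lambda>n. P n (scl a x)) \<longlonglongrightarrow> scl a (S x)"
      using bounded_linear.tendsto[OF bounded_linear_scl S] by simp
  qed
  have lin: "Vector_Spaces.linear scl scl S"
    by unfold_locales (auto simp: add scale)
  then interpret S: Vector_Spaces.linear scl scl S .
  have bl: "bounded_linear S"
  proof (rule bounded_linear_intro[OF add])
    show "S (r *\<^sub>R x) = r *\<^sub>R S x" for r x by (metis scale scale_of_real)
    show "norm (S x) \<le> norm x * \<bar>C\<bar>" for x
      by (rule Lim_bounded[OF tendsto_norm[OF S]]) (use P_bound[of _ x] in \<open>simp add: mult.commute\<close>)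
  qed
  have ip_S: "ip (S z) u = of_real (c u) * ip z u" if u: "u \<in> W" for u z
  proof (rule LIMSEQ_unique[OF bounded_linear.tendsto[OF bounded_linear_ip_left S]])
    obtain N where N: "u \<in> U N" using u by (auto simp: W_def)
    have "ip (P n z) u = of_real (c u) * ip z u" if "n \<ge> N" for n
      unfolding P_def using N mono that u
      by (intro ip_sum_orthonormal[OF onU[OF order_refl] fin]) (auto simp: incseq_def)
    then show "(\<lambda>n. ip (P n z) u) \<longlonglongrightarrow> of_real (c u) * ip z u"
      by (intro tendsto_eventually) (auto simp: eventually_sequentially)
  qed
  have S_zero: "S z = 0" if "\<And>u. u \<in> W \<Longrightarrow> ip z u = 0" for z
  proof (rule LIMSEQ_unique[OF S])
    have "P n z = 0" for n unfolding P_def using that UW[of n] by (intro sum.neutral) auto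
    then show "(\<lambda>n. P n z) \<longlonglongrightarrow> 0" by simp
  qed
  have S_eig: "S u = scl (of_real (c u)) u" if u: "u \<in> W" for u
  proof (rule LIMSEQ_unique[OF S])
    obtain N where N: "u \<in> U N" using u by (auto simp: W_def)
    have "P n u = scl (of_real (c u)) u" if "n \<ge> N" for n
    proof -
      have un: "u \<in> U n" using N mono that by (auto simp: incseq_def)
      have "P n u = (\<Sum>v\<in>U n. if v = u then scl (of_real (c u)) u else 0)"
        unfolding P_def using orthonormal_ip[OF onU[OF order_refl] un] by (intro sum.cong) auto
      then show ?thesis using un fin by simp
    qed
    then show "(\<lambda>n. P n u) \<longlonglongrightarrow> scl (of_real (c u)) u"
      by (intro tendsto_eventually) (auto simp: eventually_sequentially)
  qed
  have nS: "norm (S u) = c u" if "u \<in> W" for u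
    using S_eig[OF that] pos[OF that] orthonormal_norm[OF on that] by (simp add: norm_scl)
  have finW: "finite {u \<in> W. c u > t}" if t: "t > 0" for t
  proof -
    obtain n where "\<epsilon> n < t"
      using order_tendstoD(2)[OF \<epsilon> t] by (auto simp: eventually_sequentially)
    then have "{u \<in> W. c u > t} \<subseteq> U n" using tail[of _ n] by fastforce
    then show ?thesis by (rule finite_subset) (rule fin)
  qed
  have eqW: "{u \<in> W. Q (norm (S u))} = {u \<in> W. Q (c u)}" for Q using nS by auto
  have "eigensystem S W"
    unfolding eigensystem_def
  proof (intro conjI ballI allI impI subsetI)
    show "orthonormal W" by (rule on)
    show "S u \<noteq> 0" if "u \<in> W" for u using nS[OF that] pos[OF that] by auto
    show "S u = scl (of_real (norm (S u))) u" if "u \<in> W" for u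
      unfolding nS[OF that] by (rule S_eig[OF that])
    show "finite {u \<in> W. norm (S u) > t}" if "t > 0" for t
      unfolding eqW[of "\<lambda>r. r > t"] by (rule finW[OF that])
    fix \<mu> :: real and v assume \<mu>: "\<mu> > 0" and v: "v \<in> eigenspace scl S \<mu>"
    let ?F = "{u \<in> W. c u = \<mu>}"
    have finF: "finite ?F" by (rule finite_subset[OF _ finW[of "\<mu> / 2"]]) (use \<mu> in auto)
    have onF: "orthonormal ?F" by (rule orthonormal_subset[OF on]) auto
    define w where "w = v - (\<Sum>u\<in>?F. scl (ip v u) u)"
    have "S (\<Sum>u\<in>?F. scl (ip v u) u) = (\<Sum>u\<in>?F. scl (ip v u) (scl (of_real \<mu>) u))"
      unfolding S.sum S.scale using S_eig by (intro sum.cong) auto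
    also have "\<dots> = scl (of_real \<mu>) (\<Sum>u\<in>?F. scl (ip v u) u)"
      by (simp add: scale_sum_right scale_left_commute mult.commute)
    finally have Sw: "S w = scl (of_real \<mu>) w"
      using v by (simp add: w_def S.diff eigenspace_def scale_right_diff_distrib)
    \<comment> \<open>Off the eigenvalue \<open>\<mu>\<close>, comparing \<open>ip_S\<close> with
      \<open>Sw\<close> gives \<open>(c u - \<mu>) * ip w u = 0\<close>. Thus \<open>w\<close> is
      orthogonal to \<open>W\<close>, so \<open>S w = 0\<close> by \<open>S_zero\<close>, while also
      \<open>S w\<close> is \<open>\<mu>\<close> times \<open>w\<close>; hence
      \<open>w = 0\<close>.\<close>
    have "ip w u = 0" if "u \<in> W" for u
    proof (cases "c u = \<mu>")
      case True
      then show ?thesis using ip_residual_orthonormal[OF onF finF, of u v] that by (simp add: w_def)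
    next
      case False
      then show ?thesis using ip_S[OF that, of w] unfolding Sw by (simp add: ip_scale_left)
    qed
    then have "scl (of_real \<mu>) w = 0" using S_zero[of w] unfolding Sw by blast
    then have "w = 0" using \<mu> by simp
    then have "v = (\<Sum>u\<in>?F. scl (ip v u) u)" by (simp add: w_def)
    also have "\<dots> \<in> span ?F" by (intro span_sum span_scale span_base)
    finally show "v \<in> span {u \<in> W. norm (S u) = \<mu>}" unfolding eqW[of "\<lambda>r. r = \<mu>"] .
  qed
  then show ?thesis using that lin bl S nS unfolding P_def by blast
qed

end

section \<open>Elementary tensors and the tensor product of two operators\<close>

context hilbert_tensor_product
begin

lemma norm_tensor: "norm (tensor x y) = norm x * norm y"
proof -
  have "(norm (tensor x y))\<^sup>2 = (norm x * norm y)\<^sup>2"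
    unfolding K.norm_eq_ip ip_tensor norm_mult power_mult_distrib H.norm_eq_ip G.norm_eq_ip ..
  then show ?thesis by (simp add: power2_eq_iff_nonneg)
qed

lemma bounded_bilinear_tensor: "bounded_bilinear tensor"
proof
  interpret L: Vector_Spaces.linear scaleH scaleK "\<lambda>x. tensor x y" for y by (rule linear_left)
  interpret R: Vector_Spaces.linear scaleG scaleK "\<lambda>y. tensor x y" for x by (rule linear_right)
  show "tensor (x + x') y = tensor x y + tensor x' y" for x x' y by (rule L.add)
  show "tensor x (y + y') = tensor x y + tensor x y'" for x y y' by (rule R.add)
  show "tensor (r *\<^sub>R x) y = r *\<^sub>R tensor x y" for r x y
    using L.scale[of "of_real r" x y] by (simp add: H.scale_of_real K.scale_of_real)
  show "tensor x (r *\<^sub>R y) = r *\<^sub>R tensor x y" for r x y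
    using R.scale[of x "of_real r" y] by (simp add: G.scale_of_real K.scale_of_real)
  show "\<exists>C. \<forall>x y. norm (tensor x y) \<le> norm x * norm y * C"
    by (intro exI[of _ 1]) (simp add: norm_tensor)
qed

lemma tensor_scale: "tensor (scaleH a x) (scaleG b y) = scaleK (a * b) (tensor x y)"
proof -
  interpret L: Vector_Spaces.linear scaleH scaleK "\<lambda>x. tensor x y" for y by (rule linear_left)
  interpret R: Vector_Spaces.linear scaleG scaleK "\<lambda>y. tensor x y" for x by (rule linear_right)
  show ?thesis by (simp add: L.scale R.scale mult.commute)
qed

lemma tensor_sum: "tensor (\<Sum>i\<in>I. f i) (\<Sum>j\<in>J. g j) = (\<Sum>p\<in>I \<times> J. tensor (f (fst p)) (g (snd p)))"
proof -
  interpret L: Vector_Spaces.linear scaleH scaleK "\<lambda>x. tensor x y" for y by (rule linear_left)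
  interpret R: Vector_Spaces.linear scaleG scaleK "\<lambda>y. tensor x y" for x by (rule linear_right)
  have "tensor (\<Sum>i\<in>I. f i) (\<Sum>j\<in>J. g j) = (\<Sum>i\<in>I. \<Sum>j\<in>J. tensor (f i) (g j))"
    unfolding L.sum R.sum by (rule sum.swap)
  then show ?thesis by (simp add: sum.cartesian_product split_def)
qed

text \<open>Uniqueness for the definite description: two bounded operators that agree on elementary
  tensors agree on their span, and by continuity on its closure, which is everything.\<close>

lemma tensor_operator_eqI:
  assumes "Vector_Spaces.linear scaleK scaleK S" "bounded_linear S"
    and "\<And>x y. S (tensor x y) = tensor (A x) (B y)"
  shows "tensor_operator scaleK tensor A B = S"
  unfolding tensor_operator_def
proof (rule the_equality)
  fix S' assume S': "Vector_Spaces.linear scaleK scaleK S' \<and> bounded_linear S' \<and>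
    (\<forall>x y. S' (tensor x y) = tensor (A x) (B y))"
  interpret S: Vector_Spaces.linear scaleK scaleK S by fact
  interpret S': Vector_Spaces.linear scaleK scaleK S' using S' by blast
  have "K.span (range (\<lambda>(x, y). tensor x y)) \<subseteq> {z. S' z = S z}"
  proof
    fix z assume "z \<in> K.span (range (\<lambda>(x, y). tensor x y))"
    then show "z \<in> {z. S' z = S z}"
      by (induction rule: K.span_induct_alt)
         (use S' assms(3) in \<open>auto simp: S.add S'.add S.scale S'.scale\<close>)
  qed
  moreover have "closed {z. S' z = S z}"
    using S' assms(2) by (intro closed_Collect_eq linear_continuous_on) auto
  ultimately have "closure (K.span (range (\<lambda>(x, y). tensor x y))) \<subseteq> {z. S' z = S z}"
    by (rule closure_minimal)
  then show "S' = S" unfolding dense by auto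
qed (use assms in auto)

text \<open>A diagonal operator is built on the products of eigenvectors of the two factors and
  recognised as the tensor operator by its values on elementary tensors. Its eigensystem is then the
  product system, so nothing beyond products of eigenvalues can be counted.\<close>

lemma counting_functions_tensor:
  assumes A: "compact_operator scaleH A" "self_adjoint ipH A" "nonneg_operator ipH A"
    and B: "compact_operator scaleG B" "self_adjoint ipG B" "nonneg_operator ipG B"
  obtains E F where "\<And>e. e \<in> E \<Longrightarrow> 0 < norm (A e)" "\<And>f. f \<in> F \<Longrightarrow> 0 < norm (B f)"
    "\<And>t. 0 < t \<Longrightarrow> finite {e \<in> E. t < norm (A e)}" "\<And>t. 0 < t \<Longrightarrow> finite {f \<in> F. t < norm (B f)}"
    "\<And>t. 0 < t \<Longrightarrow> counting_function scaleH t A = card {e \<in> E. t < norm (A e)}"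
    "\<And>t. 0 < t \<Longrightarrow> counting_function scaleG t B = card {f \<in> F. t < norm (B f)}"
    "\<And>t. 0 < t \<Longrightarrow> counting_function scaleK t (tensor_operator scaleK tensor A B)
       = card {(e, f). e \<in> E \<and> f \<in> F \<and> t < norm (A e) * norm (B f)}"
proof -
  obtain E where E: "H.eigensystem A E"
    "\<And>t x. t > 0 \<Longrightarrow> norm (A x - (\<Sum>e | e \<in> E \<and> norm (A e) > t. scaleH (ipH x e) (A e))) \<le> t * norm x"
    using H.eigensystem_exists[OF A] by blast
  obtain F where F: "G.eigensystem B F"
    "\<And>t x. t > 0 \<Longrightarrow> norm (B x - (\<Sum>f | f \<in> F \<and> norm (B f) > t. scaleG (ipG x f) (B f))) \<le> t * norm x"
    using G.eigensystem_exists[OF B] by blast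
  have onE: "H.orthonormal E" and onF: "G.orthonormal F"
    using E F by (auto simp: H.eigensystem_def G.eigensystem_def)
  have posE: "0 < norm (A e)" if "e \<in> E" for e using E(1) that by (simp add: H.eigensystem_def)
  have posF: "0 < norm (B f)" if "f \<in> F" for f using F(1) that by (simp add: G.eigensystem_def)
  have finE: "finite {e \<in> E. t < norm (A e)}" if "t > 0" for t
    using E(1) that by (simp add: H.eigensystem_def)
  have finF: "finite {f \<in> F. t < norm (B f)}" if "t > 0" for t
    using F(1) that by (simp add: G.eigensystem_def)
  have linA: "Vector_Spaces.linear scaleH scaleH A" and linB: "Vector_Spaces.linear scaleG scaleG B"
    using A B by (auto simp: compact_operator_def)
  obtain CA where CA: "CA > 0" "\<And>x. norm (A x) \<le> norm x * CA"
    using bounded_linear.pos_bounded[OF H.compact_operator_bounded_linear[OF A(1)]] by blast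
  obtain CB where CB: "CB > 0" "\<And>x. norm (B x) \<le> norm x * CB"
    using bounded_linear.pos_bounded[OF G.compact_operator_bounded_linear[OF B(1)]] by blast
  have leA: "norm (A e) \<le> CA" if "e \<in> E" for e
    using CA(2)[of e] H.orthonormal_norm[OF onE that] by simp
  have leB: "norm (B f) \<le> CB" if "f \<in> F" for f
    using CB(2)[of f] G.orthonormal_norm[OF onF that] by simp
  let ?tn = "\<lambda>p. tensor (fst p) (snd p)"
  have inj: "inj_on ?tn (E \<times> F)"
  proof (rule inj_onI)
    fix p q assume p: "p \<in> E \<times> F" and q: "q \<in> E \<times> F" and "?tn p = ?tn q"
    then have "ipK (?tn p) (?tn q) = ipK (?tn p) (?tn p)" by simp
    then have "ipH (fst p) (fst q) * ipG (snd p) (snd q) = 1"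
      using p unfolding ip_tensor by (auto simp: H.orthonormal_ip[OF onE] G.orthonormal_ip[OF onF])
    then show "p = q" using p q
      by (auto simp: H.orthonormal_ip[OF onE] G.orthonormal_ip[OF onF] split: if_splits)
  qed
  \<comment> \<open>\<open>diagonal_operator\<close> expects the eigenvalue as a function of the
    vector; injectivity of \<open>?tn\<close> on \<open>E \<times> F\<close> allows the two factors
    to be recovered from it.\<close>
  define c where "c u = (let p = inv_into (E \<times> F) ?tn u in norm (A (fst p)) * norm (B (snd p)))" for u
  have c: "c (tensor e f) = norm (A e) * norm (B f)" if "e \<in> E" "f \<in> F" for e f
    using inv_into_f_f[OF inj, of "(e, f)"] that by (simp add: c_def)
  \<comment> \<open>Each factor is cut off separately rather than cutting at the size of the
    product. The truncated index set is then a Cartesian product, and the truncated expansion of an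
    elementary tensor is itself an elementary tensor.\<close>
  define EE where "EE n = {e \<in> E. 1 / real (Suc n) < norm (A e)}" for n
  define FF where "FF n = {f \<in> F. 1 / real (Suc n) < norm (B f)}" for n
  define U where "U n = ?tn ` (EE n \<times> FF n)" for n
  have mem_ev: "\<exists>n. \<forall>m\<ge>n. 1 / real (Suc m) < r" if "r > 0" for r :: real
    using order_tendstoD(2)[OF LIMSEQ_inverse_real_of_nat that]
    by (simp add: eventually_sequentially inverse_eq_divide)
  have W: "(\<Union>n. U n) = ?tn ` (E \<times> F)"
  proof (intro equalityI subsetI)
    fix u assume "u \<in> ?tn ` (E \<times> F)"
    then obtain e f where ef: "e \<in> E" "f \<in> F" "u = tensor e f" by auto
    obtain n where "\<forall>m\<ge>n. 1 / real (Suc m) < min (norm (A e)) (norm (B f))"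
      using mem_ev[of "min (norm (A e)) (norm (B f))"] posE posF ef by auto
    then have "(e, f) \<in> EE n \<times> FF n" using ef by (auto simp: EE_def FF_def)
    then show "u \<in> (\<Union>n. U n)" unfolding U_def using ef(3) by force
  qed (auto simp: U_def EE_def FF_def)
  obtain S where S: "Vector_Spaces.linear scaleK scaleK S" "bounded_linear S"
    "\<And>z. (\<lambda>n. \<Sum>u\<in>U n. scaleK (of_real (c u) * ipK z u) u) \<longlonglongrightarrow> S z"
    "\<And>u. u \<in> ?tn ` (E \<times> F) \<Longrightarrow> norm (S u) = c u" "K.eigensystem S (?tn ` (E \<times> F))"
  proof (rule K.diagonal_operator[of U c "CA * CB" "\<lambda>n. (CA + CB) * (1 / real (Suc n))", unfolded W])
    show "K.orthonormal (?tn ` (E \<times> F))"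
      using inj unfolding K.orthonormal_def
      by (auto simp: ip_tensor H.orthonormal_ip[OF onE] G.orthonormal_ip[OF onF] inj_on_def)
    show "finite (U n)" for n
      unfolding U_def EE_def FF_def by (intro finite_imageI finite_cartesian_product finE finF) auto
    have "EE m \<subseteq> EE n" "FF m \<subseteq> FF n" if "m \<le> n" for m n
    proof -
      have "1 / real (Suc n) \<le> 1 / real (Suc m)" using that by (simp add: frac_le)
      then show "EE m \<subseteq> EE n" "FF m \<subseteq> FF n" by (auto simp: EE_def FF_def)
    qed
    then show "incseq U" unfolding incseq_def U_def by (intro allI impI image_mono Sigma_mono) auto
    show "0 < c u" "c u \<le> CA * CB" if "u \<in> ?tn ` (E \<times> F)" for u
      using that posE posF leA leB CA(1) CB(1) by (auto simp: c intro!: mult_mono)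
    \<comment> \<open>Outside \<open>EE n \<times> FF n\<close> one of the two eigenvalues is at
      most \<open>1 / real (Suc n)\<close>, and the other is at most \<open>CB\<close> or
      \<open>CA\<close>.\<close>
    show "c u \<le> (CA + CB) * (1 / real (Suc n))" if u: "u \<in> ?tn ` (E \<times> F) - U n" for u n
    proof -
      obtain e f where ef: "e \<in> E" "f \<in> F" "u = tensor e f" "(e, f) \<notin> EE n \<times> FF n"
        using u unfolding U_def by force
      let ?r = "1 / real (Suc n)"
      have r: "?r \<ge> 0" by simp
      from ef consider "norm (A e) \<le> ?r" | "norm (B f) \<le> ?r" by (auto simp: EE_def FF_def not_less)
      then have "norm (A e) * norm (B f) \<le> ?r * CB \<or> norm (A e) * norm (B f) \<le> CA * ?r"
        using leA[OF ef(1)] leB[OF ef(2)] CA(1) CB(1) r by (metis mult_mono norm_ge_zero less_imp_le)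
      moreover have "0 \<le> ?r * CB" "0 \<le> CA * ?r" using CA CB r by simp_all
      ultimately have "norm (A e) * norm (B f) \<le> (CA + CB) * ?r"
        unfolding distrib_right mult.commute[of CB] by linarith
      then show ?thesis using ef by (simp add: c)
    qed
    show "(\<lambda>n. (CA + CB) * (1 / real (Suc n))) \<longlonglongrightarrow> 0"
      using tendsto_mult[OF tendsto_const LIMSEQ_inverse_real_of_nat] by (simp add: inverse_eq_divide)
  qed (rule that)
  have small: "(\<lambda>n. 1 / real (Suc n) * C) \<longlonglongrightarrow> 0" for C
    using tendsto_mult[OF LIMSEQ_inverse_real_of_nat tendsto_const, of C] by (simp add: inverse_eq_divide)
  have S_tensor: "S (tensor x y) = tensor (A x) (B y)" for x y
  proof (rule LIMSEQ_unique[OF S(3)])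
    let ?a = "\<lambda>n. \<Sum>e\<in>EE n. scaleH (ipH x e) (A e)" and ?b = "\<lambda>n. \<Sum>f\<in>FF n. scaleG (ipG y f) (B f)"
    have "(\<lambda>n. A x - ?a n) \<longlonglongrightarrow> 0"
    proof (rule Lim_null_comparison[OF always_eventually small[of "norm x"]], rule allI)
      show "norm (A x - ?a n) \<le> 1 / real (Suc n) * norm x" for n
        unfolding EE_def by (rule E(2)) simp
    qed
    then have a: "?a \<longlonglongrightarrow> A x" using tendsto_diff[OF tendsto_const, of "\<lambda>n. A x - ?a n" 0 _ "A x"] by simp
    have "(\<lambda>n. B y - ?b n) \<longlonglongrightarrow> 0"
    proof (rule Lim_null_comparison[OF always_eventually small[of "norm y"]], rule allI)
      show "norm (B y - ?b n) \<le> 1 / real (Suc n) * norm y" for n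
        unfolding FF_def by (rule F(2)) simp
    qed
    then have b: "?b \<longlonglongrightarrow> B y" using tendsto_diff[OF tendsto_const, of "\<lambda>n. B y - ?b n" 0 _ "B y"] by simp
    have "(\<Sum>u\<in>U n. scaleK (of_real (c u) * ipK (tensor x y) u) u) = tensor (?a n) (?b n)" for n
    proof -
      have sub: "EE n \<times> FF n \<subseteq> E \<times> F" by (auto simp: EE_def FF_def)
      have "tensor (scaleH (ipH x e) (A e)) (scaleG (ipG y f) (B f))
          = scaleK (of_real (c (tensor e f)) * ipK (tensor x y) (tensor e f)) (tensor e f)"
        if ef: "e \<in> E" "f \<in> F" for e f
      proof -
        have "A e = scaleH (of_real (norm (A e))) e" "B f = scaleG (of_real (norm (B f))) f"
          using E(1) F(1) ef by (auto simp: H.eigensystem_def G.eigensystem_def)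
        then have "tensor (A e) (B f) = scaleK (of_real (norm (A e)) * of_real (norm (B f))) (tensor e f)"
          using tensor_scale[of "of_real (norm (A e))" e "of_real (norm (B f))" f] by simp
        then show ?thesis
          by (simp add: tensor_scale c[OF ef] ip_tensor mult_ac)
      qed
      then show ?thesis
        unfolding U_def tensor_sum sum.reindex[OF inj_on_subset[OF inj sub]] o_def
        using sub by (intro sum.cong) auto
    qed
    then show "(\<lambda>n. \<Sum>u\<in>U n. scaleK (of_real (c u) * ipK (tensor x y) u) u) \<longlonglongrightarrow> tensor (A x) (B y)"
      using bounded_bilinear.tendsto[OF bounded_bilinear_tensor a b] by simp
  qed
  have S_eq: "tensor_operator scaleK tensor A B = S"
    by (rule tensor_operator_eqI[OF S(1,2) S_tensor])
  have "counting_function scaleK t S = card {(e, f). e \<in> E \<and> f \<in> F \<and> t < norm (A e) * norm (B f)}"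
    if "t > 0" for t
  proof -
    have "norm (S (tensor e f)) = norm (A e) * norm (B f)" if "e \<in> E" "f \<in> F" for e f
      using that S(4)[of "tensor e f"] c by force
    then have "{u \<in> ?tn ` (E \<times> F). t < norm (S u)}
        = ?tn ` {(e, f). e \<in> E \<and> f \<in> F \<and> t < norm (A e) * norm (B f)}"
      by force
    moreover have "inj_on ?tn {(e, f). e \<in> E \<and> f \<in> F \<and> t < norm (A e) * norm (B f)}"
      by (rule inj_on_subset[OF inj]) auto
    ultimately show ?thesis
      using K.counting_function_eigensystem[OF S(5,1) that] by (simp add: card_image)
  qed
  then show ?thesis
    using that[OF posE posF finE finF H.counting_function_eigensystem[OF E(1) linA]
        G.counting_function_eigensystem[OF F(1) linB]] S_eq
    by simp
qed

end

section \<open>Dyadic sums\<close>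

text \<open>The \<open>n\<close> obtained is the last one for which all of
  \<open>\<tau> / 2 ^ k\<close>, \<open>k \<le> n\<close>, stay above the threshold
  \<open>M\<close>; then \<open>\<tau> / 2 ^ n\<close> is below \<open>2 * M\<close>.\<close>

lemma dyadic_scale_exists:
  fixes M \<tau> :: real
  assumes "M > 0" "M \<le> \<tau>"
  obtains n :: nat where "M * 2 ^ n \<le> \<tau>" "\<tau> < M * 2 ^ Suc n"
proof -
  define N where "N = (LEAST n::nat. \<tau> < M * 2 ^ n)"
  obtain k :: nat where "\<tau> / M < 2 ^ k" using real_arch_pow[of 2 "\<tau> / M"] by auto
  then have "\<tau> < M * 2 ^ k" using assms(1) by (simp add: divide_less_eq mult.commute)
  then have N: "\<tau> < M * 2 ^ N" unfolding N_def by (rule LeastI)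
  then have "N \<noteq> 0" using assms(2) by (metis power_0 mult_1_right not_less)
  then obtain n where n: "N = Suc n" by (metis not0_implies_Suc)
  have "\<not> \<tau> < M * 2 ^ n" using not_less_Least[of n "\<lambda>n. \<tau> < M * 2 ^ n"] n by (simp add: N_def)
  then show ?thesis using that[of n] N n by simp
qed

text \<open>Darboux sums of \<open>f (\<tau> / \<sigma>)\<close> against \<open>g\<close> over the
  intervals from \<open>2 ^ k\<close> to \<open>2 ^ Suc k\<close>. For nondecreasing
  \<open>f\<close> the integrand is largest at the left endpoint, used here, and smallest at the
  right one, used in \<open>lower_dyadic\<close>. Both stop at \<open>2 ^ n\<close>, short of
  \<open>\<tau>\<close>.\<close>

definition upper_dyadic :: "(real \<Rightarrow> real) \<Rightarrow> (real \<Rightarrow> real) \<Rightarrow> nat \<Rightarrow> real \<Rightarrow> real"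
  where "upper_dyadic f g n \<tau> = (\<Sum>k<n. f (\<tau> / 2 ^ k) * (g (2 ^ Suc k) - g (2 ^ k)))"

definition lower_dyadic :: "(real \<Rightarrow> real) \<Rightarrow> (real \<Rightarrow> real) \<Rightarrow> nat \<Rightarrow> real \<Rightarrow> real"
  where "lower_dyadic f g n \<tau> = (\<Sum>k<n. f (\<tau> / 2 ^ Suc k) * (g (2 ^ Suc k) - g (2 ^ k)))"

text \<open>Abel summation moves the differences from \<open>g\<close> to \<open>f\<close>, leaving
  values of \<open>g\<close> that can be estimated.\<close>

lemma upper_dyadic_by_parts:
  "upper_dyadic f g n \<tau> = f (\<tau> / 2 ^ n) * g (2 ^ n) - f \<tau> * g 1
     + (\<Sum>k<n. g (2 ^ Suc k) * (f (\<tau> / 2 ^ k) - f (\<tau> / 2 ^ Suc k)))"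
  by (induction n) (simp_all add: upper_dyadic_def algebra_simps)

text \<open>Every value of \<open>f\<close> is at least the last one, and the increments of
  \<open>g\<close> telescope. Choosing \<open>n\<close> suitably makes either factor large.\<close>

lemma lower_dyadic_ge:
  assumes f: "\<And>x y. 0 < x \<Longrightarrow> x \<le> y \<Longrightarrow> f x \<le> (f y :: real)"
    and g: "\<And>x y. 0 < x \<Longrightarrow> x \<le> y \<Longrightarrow> g x \<le> (g y :: real)" and "0 < \<tau>"
  shows "f (\<tau> / 2 ^ n) * (g (2 ^ n) - g 1) \<le> lower_dyadic f g n \<tau>"
proof -
  have "f (\<tau> / 2 ^ n) * (g (2 ^ n) - g 1) = (\<Sum>k<n. f (\<tau> / 2 ^ n) * (g (2 ^ Suc k) - g (2 ^ k)))"
    using sum_lessThan_telescope[of "\<lambda>k. g (2 ^ k)" n] by (simp del: power_Suc flip: sum_distrib_left)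
  also have "\<dots> \<le> lower_dyadic f g n \<tau>"
    unfolding lower_dyadic_def
  proof (intro sum_mono mult_right_mono)
    fix k assume "k \<in> {..<n}"
    then have "(2::real) ^ Suc k \<le> 2 ^ n" by (intro power_increasing) auto
    then show "f (\<tau> / 2 ^ n) \<le> f (\<tau> / 2 ^ Suc k)" using \<open>0 < \<tau>\<close>
      by (intro f divide_left_mono) auto
    show "0 \<le> g (2 ^ Suc k) - g (2 ^ k)" using g[of "2 ^ k" "2 ^ Suc k"] by simp
  qed
  finally show ?thesis .
qed

lemma eventually_le_scale:
  fixes f r :: "real \<Rightarrow> real"
  assumes "f \<sim>[at_top] r" "\<And>x. 0 < x \<Longrightarrow> 0 \<le> r x" "1 < a"
  shows "eventually (\<lambda>x. f x \<le> a * r x) at_top"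
  using asymp_equiv_imp_eventually_le[OF assms(1,3)] eventually_gt_at_top[of 0]
  by eventually_elim (use assms(2) in fastforce)

section \<open>One-sided comparison with an abstract majorant \<open>J\<close> of lower dyadic
  sums\<close>

context
  fixes p q J :: "real \<Rightarrow> real"
  assumes p_mono: "\<And>x y. 0 < x \<Longrightarrow> x \<le> y \<Longrightarrow> p x \<le> p y" and p_nonneg: "\<And>x. 0 < x \<Longrightarrow> 0 \<le> p x"
    and q_mono: "\<And>x y. 0 < x \<Longrightarrow> x \<le> y \<Longrightarrow> q x \<le> q y" and q_nonneg: "\<And>x. 0 < x \<Longrightarrow> 0 \<le> q x"
    and p_slow: "\<And>c. 0 < c \<Longrightarrow> (\<lambda>\<tau>. p (c * \<tau>)) \<sim>[at_top] p"
    and q_slow: "\<And>c. 0 < c \<Longrightarrow> (\<lambda>\<tau>. q (c * \<tau>)) \<sim>[at_top] q"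
    and p_top: "filterlim p at_top at_top" and q_top: "filterlim q at_top at_top"
    and lower: "\<And>n \<tau>. 2 ^ n \<le> \<tau> \<Longrightarrow> lower_dyadic p q n \<tau> \<le> J \<tau>"
begin

text \<open>Here \<open>n\<close> is fixed, so large that \<open>q (2 ^ n) - q 1\<close> is at least
  \<open>2 / \<eta>\<close>; the loss of a factor 2 pays for replacing
  \<open>p (\<tau> / 2 ^ n)\<close> by \<open>p \<tau>\<close>.\<close>

lemma p_negligible:
  assumes "0 < \<eta>"
  shows "eventually (\<lambda>\<tau>. p \<tau> \<le> \<eta> * J \<tau>) at_top"
proof -
  have "eventually (\<lambda>x. q 1 + 2 / \<eta> \<le> q x) at_top"
    using q_top by (auto simp: filterlim_at_top)
  then obtain X where X: "\<And>x. x \<ge> X \<Longrightarrow> q 1 + 2 / \<eta> \<le> q x" by (auto simp: eventually_at_top_linorder)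
  obtain n :: nat where "X < 2 ^ n" using real_arch_pow[of 2 X] by auto
  then have n: "2 / \<eta> \<le> q (2 ^ n) - q 1" using X[of "2 ^ n"] by simp
  have "eventually (\<lambda>\<tau>. p \<tau> \<le> 2 * p ((1 / 2 ^ n) * \<tau>)) at_top"
  proof (rule eventually_le_scale)
    show "p \<sim>[at_top] (\<lambda>\<tau>. p ((1 / 2 ^ n) * \<tau>))"
      by (rule asymp_equiv_symI, rule p_slow) simp
    show "0 \<le> p ((1 / 2 ^ n) * \<tau>)" if "0 < \<tau>" for \<tau> using that by (simp add: p_nonneg)
  qed simp
  then show ?thesis using eventually_ge_at_top[of "2 ^ n"]
  proof eventually_elim
    case (elim \<tau>)
    have "0 < \<tau>" using elim(2) by (smt (verit) zero_less_power)
    have "2 / \<eta> * (p \<tau> / 2) \<le> (q (2 ^ n) - q 1) * p (\<tau> / 2 ^ n)"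
    proof (rule mult_mono[OF n])
      show "p \<tau> / 2 \<le> p (\<tau> / 2 ^ n)" using elim(1) by simp
      show "0 \<le> q (2 ^ n) - q 1" using q_mono[of 1 "2 ^ n"] by simp
      show "0 \<le> p \<tau> / 2" using p_nonneg[OF \<open>0 < \<tau>\<close>] by simp
    qed
    also have "\<dots> \<le> J \<tau>"
      using lower_dyadic_ge[of p q, OF p_mono q_mono \<open>0 < \<tau>\<close>, of n] lower[OF elim(2)]
      by (simp add: mult.commute)
    finally show ?case using assms by (simp add: field_simps)
  qed
qed

text \<open>Here \<open>n\<close> grows with \<open>\<tau>\<close> so that
  \<open>\<tau> / 2 ^ n\<close> stays between \<open>R\<close> and \<open>2 * R\<close>, where
  \<open>p\<close> is at least \<open>2 / \<eta>\<close>. The constants \<open>4 / 3\<close> and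
  \<open>4\<close> give \<open>q (2 ^ n) - q 1\<close> at least \<open>3/4 - 1/4 = 1/2\<close> of
  \<open>q \<tau>\<close>.\<close>

lemma q_negligible:
  assumes "0 < \<eta>"
  shows "eventually (\<lambda>\<tau>. q \<tau> \<le> \<eta> * J \<tau>) at_top"
proof -
  have "eventually (\<lambda>x. 2 / \<eta> \<le> p x) at_top"
    using p_top by (auto simp: filterlim_at_top)
  then obtain R where R: "R \<ge> 1" "2 / \<eta> \<le> p R"
    by (metis (no_types, lifting) eventually_at_top_linorder max.cobounded1 max.cobounded2)
  have "eventually (\<lambda>\<tau>. q \<tau> \<le> (4 / 3) * q ((1 / (2 * R)) * \<tau>)) at_top"
  proof (rule eventually_le_scale)
    show "q \<sim>[at_top] (\<lambda>\<tau>. q ((1 / (2 * R)) * \<tau>))"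
      by (rule asymp_equiv_symI, rule q_slow) (use R in simp)
    show "0 \<le> q ((1 / (2 * R)) * \<tau>)" if "0 < \<tau>" for \<tau> using that R by (simp add: q_nonneg)
  qed simp
  moreover have "eventually (\<lambda>x. 4 * q 1 \<le> q x) at_top"
    using q_top by (auto simp: filterlim_at_top)
  ultimately show ?thesis using eventually_ge_at_top[of R]
  proof eventually_elim
    case (elim \<tau>)
    have "0 < \<tau>" using elim(3) R(1) by simp
    obtain n where n: "R * 2 ^ n \<le> \<tau>" "\<tau> < R * 2 ^ Suc n"
      using dyadic_scale_exists[of R \<tau>] R elim(3) by auto
    have "2 ^ n \<le> R * 2 ^ n" using R(1) by simp
    then have n1: "2 ^ n \<le> \<tau>" using n(1) by linarith
    have "q ((1 / (2 * R)) * \<tau>) \<le> q (2 ^ n)"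
      using n(2) R(1) \<open>0 < \<tau>\<close> by (intro q_mono) (auto simp: divide_le_eq mult_ac)
    then have qq: "q \<tau> / 2 \<le> q (2 ^ n) - q 1" using elim(1,2) by simp
    have "R \<le> \<tau> / 2 ^ n" using n(1) by (simp add: le_divide_eq)
    then have pp: "2 / \<eta> \<le> p (\<tau> / 2 ^ n)" using p_mono[of R "\<tau> / 2 ^ n"] R by simp
    have "2 / \<eta> * (q \<tau> / 2) \<le> p (\<tau> / 2 ^ n) * (q (2 ^ n) - q 1)"
      using q_nonneg[OF \<open>0 < \<tau>\<close>] p_nonneg[of "\<tau> / 2 ^ n"] \<open>0 < \<tau>\<close> by (intro mult_mono[OF pp qq]) auto
    also have "\<dots> \<le> J \<tau>"
      using lower_dyadic_ge[of p q, OF p_mono q_mono \<open>0 < \<tau>\<close>, of n] lower[OF n1] by simp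
    finally show ?case using assms by (simp add: field_simps)
  qed
qed

text \<open>Three replacements, each costing a factor \<open>d\<close>: \<open>f\<close> by
  \<open>p\<close> termwise, \<open>g\<close> by \<open>q\<close> after summation by parts, and left
  endpoints by right endpoints after summing back. The boundary term at \<open>n\<close> is bounded
  through \<open>\<tau> / 2 ^ n < 2 * M\<close>.\<close>

lemma dyadic_sum_le:
  assumes f_mono: "\<And>x y. 0 < x \<Longrightarrow> x \<le> y \<Longrightarrow> f x \<le> (f y :: real)"
    and g_mono: "\<And>x y. 0 < x \<Longrightarrow> x \<le> y \<Longrightarrow> g x \<le> (g y :: real)" and g_nonneg: "\<And>x. 0 < x \<Longrightarrow> 0 \<le> g x"
    and fp: "\<And>x. M \<le> x \<Longrightarrow> f x \<le> d * p x" and gq: "\<And>x. M \<le> x \<Longrightarrow> g x \<le> d * q x"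
    and pd: "\<And>x. M \<le> x \<Longrightarrow> p (2 * x) \<le> d * p x"
    and M: "1 \<le> M" and d: "1 \<le> d" and n: "M * 2 ^ n \<le> \<tau>" "\<tau> < M * 2 ^ Suc n"
  shows "upper_dyadic f g n \<tau>
    \<le> d ^ 3 * lower_dyadic p q n \<tau> + d * (p (2 * M) * g \<tau> + (g M + d * q 1) * p \<tau>)"
proof -
  have "0 < M" using M by simp
  then have "0 < M * 2 ^ n" by simp
  then have \<tau>: "0 < \<tau>" using n(1) by linarith
  have scale: "M \<le> \<tau> / 2 ^ k" if "k \<le> n" for k
  proof -
    have "M * 2 ^ k \<le> M * 2 ^ n" using M that by (intro mult_left_mono power_increasing) auto
    then have "M * 2 ^ k \<le> \<tau>" using n(1) by linarith
    then show ?thesis by (simp add: le_divide_eq)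
  qed
  have inc: "0 \<le> r (2 ^ Suc k) - (r (2 ^ k) :: real)" if "\<And>x y. 0 < x \<Longrightarrow> x \<le> y \<Longrightarrow> r x \<le> r y" for r :: "real \<Rightarrow> real" and k :: nat
    using that[of "2 ^ k" "2 ^ Suc k"] by simp
  have p_inc: "0 \<le> p (\<tau> / 2 ^ k) - p (\<tau> / 2 ^ Suc k)" for k
    using p_mono[of "\<tau> / 2 ^ Suc k" "\<tau> / 2 ^ k"] \<tau> by (simp add: field_simps)
  let ?Sq = "\<Sum>k<n. q (2 ^ Suc k) * (p (\<tau> / 2 ^ k) - p (\<tau> / 2 ^ Suc k))"
  have "upper_dyadic f g n \<tau> \<le> (\<Sum>k<n. (d * p (\<tau> / 2 ^ k)) * (g (2 ^ Suc k) - g (2 ^ k)))"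
    unfolding upper_dyadic_def
    by (intro sum_mono mult_right_mono fp scale inc[OF g_mono]) auto
  also have "\<dots> = d * upper_dyadic p g n \<tau>"
    by (simp add: upper_dyadic_def sum_distrib_left mult.assoc)
  finally have 1: "upper_dyadic f g n \<tau> \<le> d * upper_dyadic p g n \<tau>" .
  have "(\<Sum>k<n. g (2 ^ Suc k) * (p (\<tau> / 2 ^ k) - p (\<tau> / 2 ^ Suc k)))
      \<le> (\<Sum>k<n. (d * q (2 ^ Suc k) + g M) * (p (\<tau> / 2 ^ k) - p (\<tau> / 2 ^ Suc k)))"
  proof (intro sum_mono mult_right_mono p_inc)
    fix k
    \<comment> \<open>\<open>gq\<close> is available only above \<open>M\<close>; below it the
      constant \<open>g M\<close> takes over, and its contribution telescopes to at most
      \<open>g M * p \<tau>\<close>.\<close>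
    show "g (2 ^ Suc k) \<le> d * q (2 ^ Suc k) + g M"
    proof (cases "M \<le> 2 ^ Suc k")
      case True
      then show ?thesis using gq[OF True] g_nonneg[OF \<open>0 < M\<close>] by linarith
    next
      case False
      then have "g (2 ^ Suc k) \<le> g M" by (intro g_mono) auto
      moreover have "0 \<le> d * q (2 ^ Suc k)" using d q_nonneg[of "2 ^ Suc k"] by simp
      ultimately show ?thesis by linarith
    qed
  qed
  also have "\<dots> = d * ?Sq + g M * (\<Sum>k<n. p (\<tau> / 2 ^ k) - p (\<tau> / 2 ^ Suc k))"
    unfolding sum_distrib_left sum.distrib[symmetric] by (intro sum.cong) (simp_all add: algebra_simps)
  also have "(\<Sum>k<n. p (\<tau> / 2 ^ k) - p (\<tau> / 2 ^ Suc k)) = p \<tau> - p (\<tau> / 2 ^ n)"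
    using sum_lessThan_telescope'[of "\<lambda>k. p (\<tau> / 2 ^ k)" n] by (simp del: power_Suc)
  also have "g M * (p \<tau> - p (\<tau> / 2 ^ n)) \<le> g M * p \<tau>"
    using g_nonneg[OF \<open>0 < M\<close>] p_nonneg[of "\<tau> / 2 ^ n"] \<tau> by (intro mult_left_mono) auto
  finally have 2: "(\<Sum>k<n. g (2 ^ Suc k) * (p (\<tau> / 2 ^ k) - p (\<tau> / 2 ^ Suc k))) \<le> d * ?Sq + g M * p \<tau>"
    by simp
  have "p (\<tau> / 2 ^ n) * g (2 ^ n) \<le> p (2 * M) * g \<tau>"
  proof (rule mult_mono)
    show "p (\<tau> / 2 ^ n) \<le> p (2 * M)"
      using n(2) \<tau> by (intro p_mono) (auto simp: divide_le_eq mult_ac)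
    have "2 ^ n \<le> M * 2 ^ n" using M by simp
    then have "2 ^ n \<le> \<tau>" using n(1) by linarith
    then show "g (2 ^ n) \<le> g \<tau>" by (intro g_mono) auto
  qed (use p_nonneg M g_nonneg in auto)
  moreover have "0 \<le> p \<tau> * g 1" using p_nonneg[OF \<tau>] g_nonneg[of 1] by simp
  ultimately have 3: "upper_dyadic p g n \<tau> \<le> p (2 * M) * g \<tau> + g M * p \<tau> + d * ?Sq"
    using 2 unfolding upper_dyadic_by_parts[of p g] by linarith
  have "0 \<le> p (\<tau> / 2 ^ n) * q (2 ^ n)" using p_nonneg[of "\<tau> / 2 ^ n"] q_nonneg[of "2 ^ n"] \<tau> by simp
  then have 4: "?Sq \<le> upper_dyadic p q n \<tau> + q 1 * p \<tau>"
    unfolding upper_dyadic_by_parts[of p q] by (simp add: mult.commute)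
  have "upper_dyadic p q n \<tau> \<le> (\<Sum>k<n. (d * p (\<tau> / 2 ^ Suc k)) * (q (2 ^ Suc k) - q (2 ^ k)))"
    unfolding upper_dyadic_def
  proof (intro sum_mono mult_right_mono inc[OF q_mono])
    fix k assume "k \<in> {..<n}"
    then show "p (\<tau> / 2 ^ k) \<le> d * p (\<tau> / 2 ^ Suc k)" using pd[OF scale[of "Suc k"]] by simp
  qed
  also have "\<dots> = d * lower_dyadic p q n \<tau>"
    by (simp add: lower_dyadic_def sum_distrib_left mult.assoc)
  finally have 5: "upper_dyadic p q n \<tau> \<le> d * lower_dyadic p q n \<tau>" .
  have d0: "0 \<le> d" using d by simp
  have "?Sq \<le> d * lower_dyadic p q n \<tau> + q 1 * p \<tau>" using 4 5 by linarith
  from mult_left_mono[OF this d0]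
  have "upper_dyadic p g n \<tau> \<le> p (2 * M) * g \<tau> + g M * p \<tau> + d * (d * lower_dyadic p q n \<tau> + q 1 * p \<tau>)"
    using 3 by linarith
  from mult_left_mono[OF this d0] 1
  have "upper_dyadic f g n \<tau>
      \<le> d * (p (2 * M) * g \<tau> + g M * p \<tau> + d * (d * lower_dyadic p q n \<tau> + q 1 * p \<tau>))"
    by linarith
  then show ?thesis by (simp add: power3_eq_cube algebra_simps)
qed

text \<open>\<open>I\<close> and \<open>J\<close> stay abstract so that the pair count and the
  convolution integral can take either role. The factor \<open>L\<close> may depend on
  \<open>M\<close> but not on \<open>n\<close> or \<open>\<tau>\<close>, so once \<open>M\<close> is
  fixed the error is absorbed by negligibility; the dilation \<open>C\<close> is absorbed by slow
  variation.\<close>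

lemma dyadic_convolution_le:
  assumes f_mono: "\<And>x y. 0 < x \<Longrightarrow> x \<le> y \<Longrightarrow> f x \<le> (f y :: real)"
    and g_mono: "\<And>x y. 0 < x \<Longrightarrow> x \<le> y \<Longrightarrow> g x \<le> (g y :: real)" and g_nonneg: "\<And>x. 0 < x \<Longrightarrow> 0 \<le> g x"
    and fp: "f \<sim>[at_top] p" and gq: "g \<sim>[at_top] q" and C: "0 < C"
    and upper: "\<And>M. 1 \<le> M \<Longrightarrow> \<exists>L\<ge>0. \<forall>n \<tau>. M * 2 ^ n \<le> \<tau> \<longrightarrow> \<tau> < M * 2 ^ Suc n \<longrightarrow>
      I \<tau> \<le> upper_dyadic f g n \<tau> + L * (f (C * \<tau>) + g (C * \<tau>))"
    and \<epsilon>: "0 < \<epsilon>"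
  shows "eventually (\<lambda>\<tau>. I \<tau> \<le> (1 + \<epsilon>) * J \<tau>) at_top"
proof -
  \<comment> \<open>For \<open>\<delta> \<le> 1\<close> the cube \<open>(1 + \<delta>) ^ 3\<close>
    is at most \<open>1 + 7 * \<delta>\<close>, which should not exceed
    \<open>1 + \<epsilon> / 2\<close>.\<close>
  define \<delta> where "\<delta> = min 1 (\<epsilon> / 14)"
  define d where "d = 1 + \<delta>"
  have \<delta>: "0 < \<delta>" "\<delta> \<le> 1" "\<delta> \<le> \<epsilon> / 14" using \<epsilon> by (auto simp: \<delta>_def)
  have d: "1 < d" "d \<le> 2" using \<delta> by (auto simp: d_def)
  have "\<delta>\<^sup>2 \<le> \<delta>" "\<delta> ^ 3 \<le> \<delta>" using \<delta> power_decreasing[of 1 2 \<delta>] power_decreasing[of 1 3 \<delta>] by auto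
  moreover have "d ^ 3 = 1 + 3 * \<delta> + 3 * \<delta>\<^sup>2 + \<delta> ^ 3"
    by (simp add: d_def power3_eq_cube power2_eq_square algebra_simps)
  ultimately have d3: "d ^ 3 \<le> 1 + \<epsilon> / 2" using \<delta>(3) by linarith
  have "eventually (\<lambda>x. f x \<le> d * p x \<and> g x \<le> d * q x \<and> p (2 * x) \<le> d * p x) at_top"
    using p_slow[of 2]
    by (intro eventually_conj eventually_le_scale fp gq p_nonneg q_nonneg d(1)) simp_all
  then obtain M0 where M0: "\<And>x. x \<ge> M0 \<Longrightarrow> f x \<le> d * p x \<and> g x \<le> d * q x \<and> p (2 * x) \<le> d * p x"
    by (auto simp: eventually_at_top_linorder)
  define M where "M = max 1 M0"
  have M: "1 \<le> M" "M0 \<le> M" by (auto simp: M_def)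
  obtain L where L: "0 \<le> L" "\<And>n \<tau>. M * 2 ^ n \<le> \<tau> \<Longrightarrow> \<tau> < M * 2 ^ Suc n \<Longrightarrow>
      I \<tau> \<le> upper_dyadic f g n \<tau> + L * (f (C * \<tau>) + g (C * \<tau>))"
    using upper[OF M(1)] by blast
  have Ct: "filterlim (\<lambda>\<tau>. C * \<tau>) at_top at_top"
    using C by (simp add: filterlim_tendsto_pos_mult_at_top[OF tendsto_const _ filterlim_ident])
  have fC: "(\<lambda>\<tau>. f (C * \<tau>)) \<sim>[at_top] p" and gC: "(\<lambda>\<tau>. g (C * \<tau>)) \<sim>[at_top] q"
    using asymp_equiv_trans[OF asymp_equiv_compose'[OF fp Ct] p_slow[OF C]]
      asymp_equiv_trans[OF asymp_equiv_compose'[OF gq Ct] q_slow[OF C]] by auto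
  \<comment> \<open>\<open>a\<close> and \<open>b\<close> collect the coefficients of
    \<open>p \<tau>\<close> and \<open>q \<tau>\<close> in all error terms; \<open>\<eta>\<close> is
    then chosen so that together they cost at most \<open>\<epsilon> / 4 * J \<tau>\<close>.\<close>
  define a where "a = 2 * (g M + 2 * q 1) + 2 * L"
  define b where "b = 4 * p (2 * M) + 2 * L"
  have ab: "0 \<le> a" "0 \<le> b"
    using g_nonneg[of M] q_nonneg[of 1] p_nonneg[of "2 * M"] M L by (auto simp: a_def b_def)
  define \<eta> where "\<eta> = \<epsilon> / (4 * (a + b + 1))"
  have \<eta>: "0 < \<eta>" using ab \<epsilon> by (simp add: \<eta>_def)
  have ev: "eventually (\<lambda>x. f (C * x) \<le> 2 * p x \<and> g (C * x) \<le> 2 * q x \<and> g x \<le> 2 * q x) at_top"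
    by (intro eventually_conj eventually_le_scale fC gC gq p_nonneg q_nonneg) simp_all
  show ?thesis
    using ev p_negligible[OF \<eta>] q_negligible[OF \<eta>] eventually_ge_at_top[of M]
  proof eventually_elim
    case (elim \<tau>)
    have \<tau>: "0 < \<tau>" using elim(4) M(1) by simp
    obtain n where n: "M * 2 ^ n \<le> \<tau>" "\<tau> < M * 2 ^ Suc n"
      using dyadic_scale_exists[of M \<tau>] M elim(4) by auto
    have "2 ^ n \<le> M * 2 ^ n" using M(1) by simp
    then have "2 ^ n \<le> \<tau>" using n(1) by linarith
    note low = lower[OF this]
    have "0 \<le> \<eta> * J \<tau>" using elim(2) p_nonneg[OF \<tau>] by linarith
    then have J0: "0 \<le> J \<tau>" using \<eta> by (simp add: zero_le_mult_iff)
    have "upper_dyadic f g n \<tau>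
        \<le> d ^ 3 * lower_dyadic p q n \<tau> + d * (p (2 * M) * g \<tau> + (g M + d * q 1) * p \<tau>)"
      using M0 M d by (intro dyadic_sum_le f_mono g_mono g_nonneg n) auto
    also have "d ^ 3 * lower_dyadic p q n \<tau> \<le> d ^ 3 * J \<tau>"
      using low d by (intro mult_left_mono) auto
    also have "d ^ 3 * J \<tau> \<le> (1 + \<epsilon> / 2) * J \<tau>" using d3 J0 by (intro mult_right_mono)
    also have "d * (p (2 * M) * g \<tau> + (g M + d * q 1) * p \<tau>)
        \<le> 2 * (p (2 * M) * (2 * q \<tau>) + (g M + 2 * q 1) * p \<tau>)"
      using d elim(1) p_nonneg[of "2 * M"] p_nonneg[OF \<tau>] q_nonneg[OF \<tau>] q_nonneg[of 1] g_nonneg[of M]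
        g_nonneg[OF \<tau>] M
      by (intro mult_mono add_mono order_refl add_nonneg_nonneg mult_nonneg_nonneg) auto
    finally have "upper_dyadic f g n \<tau>
        \<le> (1 + \<epsilon> / 2) * J \<tau> + 2 * (p (2 * M) * (2 * q \<tau>) + (g M + 2 * q 1) * p \<tau>)" by simp
    moreover have "L * (f (C * \<tau>) + g (C * \<tau>)) \<le> L * (2 * p \<tau> + 2 * q \<tau>)"
      using L(1) elim(1) by (intro mult_left_mono add_mono) auto
    ultimately have "I \<tau> \<le> (1 + \<epsilon> / 2) * J \<tau> + (a * p \<tau> + b * q \<tau>)"
      using L(2)[OF n] by (simp add: a_def b_def algebra_simps)
    also have "a * p \<tau> + b * q \<tau> \<le> a * (\<eta> * J \<tau>) + b * (\<eta> * J \<tau>)"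
      using elim(2,3) ab by (intro add_mono mult_left_mono)
    also have "\<dots> \<le> (a + b + 1) * \<eta> * J \<tau>" using \<open>0 \<le> \<eta> * J \<tau>\<close> by (simp add: algebra_simps)
    also have "(a + b + 1) * \<eta> = \<epsilon> / 4" using ab by (simp add: \<eta>_def field_simps)
    finally have "I \<tau> \<le> (1 + \<epsilon> / 2) * J \<tau> + \<epsilon> / 4 * J \<tau>" by simp
    also have "\<dots> \<le> (1 + \<epsilon>) * J \<tau>" using J0 \<epsilon> by (simp add: algebra_simps)
    finally show ?case .
  qed
qed

end

lemma asymp_equivI_le:
  fixes I J :: "real \<Rightarrow> real"
  assumes le: "\<And>\<epsilon>. 0 < \<epsilon> \<Longrightarrow> eventually (\<lambda>\<tau>. I \<tau> \<le> (1 + \<epsilon>) * J \<tau>) F"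
    and ge: "\<And>\<epsilon>. 0 < \<epsilon> \<Longrightarrow> eventually (\<lambda>\<tau>. J \<tau> \<le> (1 + \<epsilon>) * I \<tau>) F"
    and nonneg: "eventually (\<lambda>\<tau>. 0 \<le> J \<tau>) F"
  shows "I \<sim>[F] J"
proof (rule smallo_imp_asymp_equiv, rule landau_o.smallI)
  fix c :: real assume c: "0 < c"
  \<comment> \<open>The reverse estimate reads \<open>J - I \<le> \<epsilon> * I \<le> \<epsilon> *
    (1 + \<epsilon>) * J\<close>, so \<open>1 + \<epsilon> \<le> 2\<close> and
    \<open>2 * \<epsilon> \<le> c\<close> are wanted.\<close>
  define \<epsilon> where "\<epsilon> = min 1 (c / 2)"
  have \<epsilon>: "0 < \<epsilon>" "\<epsilon> \<le> 1" "2 * \<epsilon> \<le> c" using c by (auto simp: \<epsilon>_def)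
  show "eventually (\<lambda>\<tau>. norm (I \<tau> - J \<tau>) \<le> c * norm (J \<tau>)) F"
    using le[OF \<epsilon>(1)] ge[OF \<epsilon>(1)] nonneg
  proof eventually_elim
    case (elim \<tau>)
    have "\<epsilon> * J \<tau> \<le> c * J \<tau>" using \<epsilon> elim(3) by (intro mult_right_mono) auto
    then have 1: "I \<tau> - J \<tau> \<le> c * J \<tau>" using elim(1) by (simp add: algebra_simps)
    have "\<epsilon> * I \<tau> \<le> \<epsilon> * ((1 + \<epsilon>) * J \<tau>)" using \<epsilon> elim(1) by (intro mult_left_mono) auto
    also have "\<dots> \<le> \<epsilon> * (2 * J \<tau>)" using \<epsilon> elim(3) by (intro mult_left_mono mult_right_mono) auto
    also have "\<dots> = 2 * \<epsilon> * J \<tau>" by simp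
    also have "\<dots> \<le> c * J \<tau>" using \<epsilon> elim(3) by (intro mult_right_mono) auto
    finally have "J \<tau> - I \<tau> \<le> c * J \<tau>" using elim(2) by (simp add: algebra_simps)
    with 1 show ?case using elim(3) by (simp add: abs_le_iff)
  qed
qed

section \<open>Convolution integrals and pair counts\<close>

context
  fixes \<phi> \<psi> :: "real \<Rightarrow> real"
  assumes \<phi>_mono: "\<And>x y. 0 < x \<Longrightarrow> x \<le> y \<Longrightarrow> \<phi> x \<le> \<phi> y" and \<phi>_nonneg: "\<And>x. 0 < x \<Longrightarrow> 0 \<le> \<phi> x"
    and \<psi>_mono: "\<And>x y. 0 < x \<Longrightarrow> x \<le> y \<Longrightarrow> \<psi> x \<le> \<psi> y" and \<psi>_nonneg: "\<And>x. 0 < x \<Longrightarrow> 0 \<le> \<psi> x"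
    and \<phi>_cont: "continuous_on {0<..} \<phi>" and \<psi>_cont: "continuous_on {0<..} \<psi>"
begin

abbreviation (input) "stieltjes \<equiv> interval_measure (\<lambda>\<sigma>. \<psi> (max 1 \<sigma>))"

lemma stieltjes_cont: "continuous_on UNIV (\<lambda>\<sigma>. \<psi> (max 1 \<sigma>))"
  by (rule continuous_on_compose2[OF \<psi>_cont]) (auto intro!: continuous_intros)

text \<open>Continuity of \<open>\<psi>\<close> excludes atoms, so closed and half-open intervals
  have the same mass and \<open>{1}\<close> is a null set.\<close>

lemma emeasure_stieltjes:
  assumes "1 \<le> a" "a \<le> b"
  shows "emeasure stieltjes {a..b} = ennreal (\<psi> b - \<psi> a)" "emeasure stieltjes {a<..b} = ennreal (\<psi> b - \<psi> a)"
proof -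
  have mono: "\<psi> (max 1 x) \<le> \<psi> (max 1 y)" if "x \<le> y" for x y using that by (intro \<psi>_mono) auto
  have rc: "continuous (at_right x) (\<lambda>\<sigma>. \<psi> (max 1 \<sigma>))" for x
    using stieltjes_cont by (simp add: continuous_on_eq_continuous_at continuous_at_imp_continuous_at_within)
  show "emeasure stieltjes {a..b} = ennreal (\<psi> b - \<psi> a)"
    using emeasure_interval_measure_Icc[OF assms(2) mono stieltjes_cont] assms by simp
  show "emeasure stieltjes {a<..b} = ennreal (\<psi> b - \<psi> a)"
    using emeasure_interval_measure_Ioc[OF assms(2) mono rc] assms by simp
qed

lemma stieltjes_integrable:
  assumes "A \<in> sets borel" "A \<subseteq> {1..\<tau>}"
  shows "set_integrable stieltjes A (\<lambda>\<sigma>. \<phi> (\<tau> / \<sigma>))"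
proof (cases "1 \<le> \<tau>")
  case True
  have "set_integrable stieltjes {1..\<tau>} (\<lambda>\<sigma>. \<phi> (\<tau> / \<sigma>))"
    unfolding set_integrable_def
  proof (rule Bochner_Integration.integrable_bound)
    show "integrable stieltjes (\<lambda>x. indicator {1..\<tau>} x *\<^sub>R \<phi> \<tau>)"
      using emeasure_stieltjes(1)[of 1 \<tau>] True by simp
    have "continuous_on {1..\<tau>} (\<lambda>\<sigma>. \<phi> (\<tau> / \<sigma>))"
      using True by (intro continuous_on_compose2[OF \<phi>_cont] continuous_intros) auto
    then show "(\<lambda>x. indicator {1..\<tau>} x *\<^sub>R \<phi> (\<tau> / x)) \<in> borel_measurable stieltjes"
      using borel_measurable_continuous_on_indicator[of "{1..\<tau>}" "\<lambda>\<sigma>. \<phi> (\<tau> / \<sigma>)"] by simp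
    have "norm (indicator {1..\<tau>} x *\<^sub>R \<phi> (\<tau> / x)) \<le> norm (indicator {1..\<tau>} x *\<^sub>R \<phi> \<tau>)" for x
    proof (cases "x \<in> {1..\<tau>}")
      case True
      then have "0 < \<tau> / x" "\<tau> / x \<le> \<tau>" by (auto simp: divide_le_eq)
      then have "0 \<le> \<phi> (\<tau> / x)" "\<phi> (\<tau> / x) \<le> \<phi> \<tau>" using \<phi>_mono \<phi>_nonneg by auto
      then show ?thesis using True by simp
    qed simp
    then show "AE x in stieltjes. norm (indicator {1..\<tau>} x *\<^sub>R \<phi> (\<tau> / x)) \<le> norm (indicator {1..\<tau>} x *\<^sub>R \<phi> \<tau>)"
      by simp
  qed
  then show ?thesis by (rule set_integrable_subset) (use assms in auto)
next
  case False
  then have "A = {}" using assms(2) by auto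
  then show ?thesis by (simp add: set_integrable_def)
qed

lemma stieltjes_integral_bounds:
  assumes "1 \<le> a" "a \<le> b" "b \<le> \<tau>"
  shows "\<phi> (\<tau> / b) * (\<psi> b - \<psi> a) \<le> (LINT \<sigma>:{a<..b}|stieltjes. \<phi> (\<tau> / \<sigma>))"
    and "(LINT \<sigma>:{a<..b}|stieltjes. \<phi> (\<tau> / \<sigma>)) \<le> \<phi> (\<tau> / a) * (\<psi> b - \<psi> a)"
proof -
  have emeas: "emeasure stieltjes {a<..b} = ennreal (\<psi> b - \<psi> a)"
    by (rule emeasure_stieltjes(2)) (use assms in auto)
  have "measure stieltjes {a<..b} = \<psi> b - \<psi> a"
    using emeas \<psi>_mono[of a b] assms by (simp add: measure_def)
  then have const: "(LINT \<sigma>:{a<..b}|stieltjes. c) = c * (\<psi> b - \<psi> a)" for c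
    using set_integral_const[of "{a<..b}" stieltjes c] emeas by (simp add: mult.commute)
  have int: "set_integrable stieltjes {a<..b} (\<lambda>\<sigma>. \<phi> (\<tau> / \<sigma>))"
    using assms by (intro stieltjes_integrable) auto
  have intc: "set_integrable stieltjes {a<..b} (\<lambda>\<sigma>. c)" for c :: real
    unfolding set_integrable_def using emeas by simp
  have "\<phi> (\<tau> / b) \<le> \<phi> (\<tau> / \<sigma>)" "\<phi> (\<tau> / \<sigma>) \<le> \<phi> (\<tau> / a)" if "\<sigma> \<in> {a<..b}" for \<sigma>
    using that assms by (auto intro!: \<phi>_mono divide_left_mono)
  then show "\<phi> (\<tau> / b) * (\<psi> b - \<psi> a) \<le> (LINT \<sigma>:{a<..b}|stieltjes. \<phi> (\<tau> / \<sigma>))"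
    "(LINT \<sigma>:{a<..b}|stieltjes. \<phi> (\<tau> / \<sigma>)) \<le> \<phi> (\<tau> / a) * (\<psi> b - \<psi> a)"
    unfolding const[symmetric] by (intro set_integral_mono int intc; blast)+
qed

lemma stieltjes_integral_split:
  assumes "1 \<le> a" "a \<le> b" "b \<le> c" "c \<le> \<tau>"
  shows "(LINT \<sigma>:{a<..c}|stieltjes. \<phi> (\<tau> / \<sigma>))
    = (LINT \<sigma>:{a<..b}|stieltjes. \<phi> (\<tau> / \<sigma>)) + (LINT \<sigma>:{b<..c}|stieltjes. \<phi> (\<tau> / \<sigma>))"
proof -
  have "{a<..c} = {a<..b} \<union> {b<..c}" using assms by auto
  then show ?thesis
    using assms by (simp only:) (intro set_integral_Un stieltjes_integrable; auto)
qed

text \<open>Half-open intervals tile the range of integration without overlap; the point 1 lost in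
  this way carries no mass.\<close>

lemma asymptotic_convolution_Ioc:
  assumes "1 \<le> \<tau>"
  shows "(\<phi> \<star> \<psi>) \<tau> = (LINT \<sigma>:{1<..\<tau>}|stieltjes. \<phi> (\<tau> / \<sigma>))"
proof -
  have "{1..\<tau>} = {1} \<union> {1<..\<tau>}" using assms by auto
  then have "(\<phi> \<star> \<psi>) \<tau> = (LINT \<sigma>:{1}|stieltjes. \<phi> (\<tau> / \<sigma>)) + (LINT \<sigma>:{1<..\<tau>}|stieltjes. \<phi> (\<tau> / \<sigma>))"
    unfolding asymptotic_convolution_def using assms
    by (simp only:) (intro set_integral_Un stieltjes_integrable; auto)
  moreover have "(LINT \<sigma>:{1}|stieltjes. \<phi> (\<tau> / \<sigma>)) = (LINT \<sigma>:{1}|stieltjes. \<phi> \<tau>)"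
    by (rule set_lebesgue_integral_cong) auto
  moreover have "emeasure stieltjes {1} = 0" using emeasure_stieltjes(1)[of 1 1] by simp
  ultimately show ?thesis by (simp add: set_integral_const measure_def)
qed

lemma dyadic_integral_bounds:
  assumes "2 ^ n \<le> \<tau>"
  shows "lower_dyadic \<phi> \<psi> n \<tau> \<le> (LINT \<sigma>:{1<..2 ^ n}|stieltjes. \<phi> (\<tau> / \<sigma>))"
    and "(LINT \<sigma>:{1<..2 ^ n}|stieltjes. \<phi> (\<tau> / \<sigma>)) \<le> upper_dyadic \<phi> \<psi> n \<tau>"
proof -
  have "lower_dyadic \<phi> \<psi> n \<tau> \<le> (LINT \<sigma>:{1<..2 ^ n}|stieltjes. \<phi> (\<tau> / \<sigma>)) \<and>
    (LINT \<sigma>:{1<..2 ^ n}|stieltjes. \<phi> (\<tau> / \<sigma>)) \<le> upper_dyadic \<phi> \<psi> n \<tau>"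
    using assms
  proof (induction n)
    case 0
    then show ?case by (simp add: lower_dyadic_def upper_dyadic_def set_lebesgue_integral_def)
  next
    case (Suc n)
    have n: "(1::real) \<le> 2 ^ n" "(2::real) ^ n \<le> 2 ^ Suc n" by auto
    then have "2 ^ n \<le> \<tau>" using Suc.prems by linarith
    then show ?case
      using Suc.IH stieltjes_integral_split[OF order_refl n Suc.prems] stieltjes_integral_bounds[OF n Suc.prems]
      unfolding lower_dyadic_def upper_dyadic_def sum.lessThan_Suc by linarith
  qed
  then show "lower_dyadic \<phi> \<psi> n \<tau> \<le> (LINT \<sigma>:{1<..2 ^ n}|stieltjes. \<phi> (\<tau> / \<sigma>))"
    "(LINT \<sigma>:{1<..2 ^ n}|stieltjes. \<phi> (\<tau> / \<sigma>)) \<le> upper_dyadic \<phi> \<psi> n \<tau>" by auto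
qed

lemma asymptotic_convolution_split:
  assumes "2 ^ n \<le> \<tau>"
  shows "(\<phi> \<star> \<psi>) \<tau>
    = (LINT \<sigma>:{1<..2 ^ n}|stieltjes. \<phi> (\<tau> / \<sigma>)) + (LINT \<sigma>:{2 ^ n<..\<tau>}|stieltjes. \<phi> (\<tau> / \<sigma>))"
proof -
  have n: "(1::real) \<le> 2 ^ n" by simp
  then have "1 \<le> \<tau>" using assms by linarith
  then show ?thesis
    using stieltjes_integral_split[OF order_refl n assms order_refl] by (simp add: asymptotic_convolution_Ioc)
qed

lemma lower_dyadic_le_asymptotic_convolution:
  assumes "2 ^ n \<le> \<tau>"
  shows "lower_dyadic \<phi> \<psi> n \<tau> \<le> (\<phi> \<star> \<psi>) \<tau>"
proof -
  have n: "(1::real) \<le> 2 ^ n" by simp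
  then have "0 < \<tau>" using assms by linarith
  then have "0 \<le> \<phi> (\<tau> / \<tau>) * (\<psi> \<tau> - \<psi> (2 ^ n))"
    using assms \<psi>_mono[OF _ assms] \<phi>_nonneg[of 1] by (intro mult_nonneg_nonneg) auto
  then show ?thesis
    using stieltjes_integral_bounds(1)[OF n assms order_refl] dyadic_integral_bounds(1)[OF assms]
    unfolding asymptotic_convolution_split[OF assms] by linarith
qed

text \<open>The error is the integral over the last piece, from \<open>2 ^ n\<close> to
  \<open>\<tau>\<close>, where \<open>\<tau> / \<sigma> < 2 * M\<close> bounds the integrand by
  \<open>\<phi> (2 * M)\<close>.\<close>

lemma asymptotic_convolution_le_upper_dyadic:
  assumes "1 \<le> M" "M * 2 ^ n \<le> \<tau>" "\<tau> < M * 2 ^ Suc n"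
  shows "(\<phi> \<star> \<psi>) \<tau> \<le> upper_dyadic \<phi> \<psi> n \<tau> + \<phi> (2 * M) * (\<phi> \<tau> + \<psi> \<tau>)"
proof -
  have n: "(1::real) \<le> 2 ^ n" by simp
  have "2 ^ n \<le> M * 2 ^ n" using assms(1) by simp
  then have n\<tau>: "2 ^ n \<le> \<tau>" using assms(2) by linarith
  then have \<tau>: "0 < \<tau>" using n by linarith
  have "\<phi> (\<tau> / 2 ^ n) * (\<psi> \<tau> - \<psi> (2 ^ n)) \<le> \<phi> (2 * M) * (\<phi> \<tau> + \<psi> \<tau>)"
  proof (rule mult_mono)
    show "\<phi> (\<tau> / 2 ^ n) \<le> \<phi> (2 * M)"
      using assms(3) \<tau> by (intro \<phi>_mono) (auto simp: divide_le_eq mult_ac)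
    show "\<psi> \<tau> - \<psi> (2 ^ n) \<le> \<phi> \<tau> + \<psi> \<tau>" using \<phi>_nonneg[OF \<tau>] \<psi>_nonneg[of "2 ^ n"] by simp
    show "0 \<le> \<phi> (2 * M)" using \<phi>_nonneg assms(1) by simp
    show "0 \<le> \<psi> \<tau> - \<psi> (2 ^ n)" using \<psi>_mono[OF _ n\<tau>] by simp
  qed
  then show ?thesis
    using stieltjes_integral_bounds(2)[OF n n\<tau> order_refl] dyadic_integral_bounds(2)[OF n\<tau>]
    unfolding asymptotic_convolution_split[OF n\<tau>] by linarith
qed

end

text \<open>The parameter is \<open>x = 1 / t\<close>: the cardinality becomes nondecreasing in
  \<open>x\<close> and is compared with a slowly varying function at infinity.\<close>

definition level_set :: "('a \<Rightarrow> real) \<Rightarrow> 'a set \<Rightarrow> real \<Rightarrow> 'a set"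
  where "level_set \<alpha> E x = {e \<in> E. 1 / x < \<alpha> e}"

lemma level_set_iff: "0 < x \<Longrightarrow> e \<in> level_set \<alpha> E x \<longleftrightarrow> e \<in> E \<and> 1 < \<alpha> e * x"
  by (auto simp: level_set_def divide_less_eq)

lemma finite_level_set:
  "(\<And>t. 0 < t \<Longrightarrow> finite {e \<in> E. t < \<alpha> e}) \<Longrightarrow> 0 < x \<Longrightarrow> finite (level_set \<alpha> E x)"
  by (simp add: level_set_def)

lemma level_set_mono: "0 < x \<Longrightarrow> x \<le> y \<Longrightarrow> level_set \<alpha> E x \<subseteq> level_set \<alpha> E y"
  unfolding level_set_def using frac_le[of 1 1 x y] by auto

section \<open>Counting pairs by rectangles over dyadic shells\<close>

context
  fixes \<alpha> :: "'a \<Rightarrow> real" and \<beta> :: "'b \<Rightarrow> real" and E :: "'a set" and F :: "'b set"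
  assumes \<alpha>_pos: "\<And>e. e \<in> E \<Longrightarrow> 0 < \<alpha> e" and \<beta>_pos: "\<And>f. f \<in> F \<Longrightarrow> 0 < \<beta> f"
    and finE: "\<And>t. 0 < t \<Longrightarrow> finite {e \<in> E. t < \<alpha> e}"
    and finF: "\<And>t. 0 < t \<Longrightarrow> finite {f \<in> F. t < \<beta> f}"
begin

abbreviation (input) "product_level \<equiv> level_set (\<lambda>(e, f). \<alpha> e * \<beta> f) (E \<times> F)"

lemma product_level_iff:
  "0 < x \<Longrightarrow> (e, f) \<in> product_level x \<longleftrightarrow> e \<in> E \<and> f \<in> F \<and> 1 < \<alpha> e * \<beta> f * x"
  by (simp add: level_set_iff)

lemmas finite_levelE = finite_level_set[OF finE]
lemmas finite_levelF = finite_level_set[OF finF]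

text \<open>Only finitely many weights exceed 1, so a maximum over those and 1 suffices.\<close>

lemma weights_bounded:
  obtains C where "1 \<le> C" "\<And>e. e \<in> E \<Longrightarrow> \<alpha> e \<le> C" "\<And>f. f \<in> F \<Longrightarrow> \<beta> f \<le> C"
proof -
  let ?S = "insert 1 (\<alpha> ` {e \<in> E. 1 < \<alpha> e} \<union> \<beta> ` {f \<in> F. 1 < \<beta> f})"
  have fin: "finite ?S" using finE[of 1] finF[of 1] by auto
  have "1 \<le> Max ?S" using fin by (intro Max_ge) auto
  moreover have "\<alpha> e \<le> Max ?S" if "e \<in> E" for e
    using that \<open>1 \<le> Max ?S\<close> Max_ge[OF fin, of "\<alpha> e"] by (cases "1 < \<alpha> e") auto
  moreover have "\<beta> f \<le> Max ?S" if "f \<in> F" for f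
    using that \<open>1 \<le> Max ?S\<close> Max_ge[OF fin, of "\<beta> f"] by (cases "1 < \<beta> f") auto
  ultimately show ?thesis by (rule that)
qed

lemma finite_product_level:
  assumes "0 < x" shows "finite (product_level x)"
proof -
  obtain C where C: "1 \<le> C" "\<And>e. e \<in> E \<Longrightarrow> \<alpha> e \<le> C" "\<And>f. f \<in> F \<Longrightarrow> \<beta> f \<le> C"
    using weights_bounded by metis
  have Cx: "0 < C * x" using C(1) assms by simp
  have "product_level x \<subseteq> level_set \<alpha> E (C * x) \<times> level_set \<beta> F (C * x)"
  proof (rule subrelI)
    fix e f assume "(e, f) \<in> product_level x"
    then have ef: "e \<in> E" "f \<in> F" "1 < \<alpha> e * \<beta> f * x" using product_level_iff[OF assms] by auto
    have "\<alpha> e * \<beta> f * x \<le> \<alpha> e * C * x" "\<alpha> e * \<beta> f * x \<le> C * \<beta> f * x"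
      using C ef \<alpha>_pos[OF ef(1)] \<beta>_pos[OF ef(2)] assms by (auto intro!: mult_right_mono mult_left_mono)
    then have "1 < \<alpha> e * (C * x)" "1 < \<beta> f * (C * x)" using ef(3) by (simp_all add: mult_ac)
    then show "(e, f) \<in> level_set \<alpha> E (C * x) \<times> level_set \<beta> F (C * x)"
      using ef by (simp add: level_set_iff[OF Cx])
  qed
  then show ?thesis by (rule finite_subset) (intro finite_cartesian_product finite_levelE finite_levelF Cx)
qed

text \<open>The \<open>f\<close> with \<open>2 ^ k \<le> 1 / \<beta> f < 2 ^ Suc k\<close>; their
  number is the increment that plays the role of the Stieltjes mass of a dyadic interval.\<close>

definition "shell k = level_set \<beta> F (2 ^ Suc k) - level_set \<beta> F (2 ^ k)"

lemma card_shell: "real (card (shell k)) = real (card (level_set \<beta> F (2 ^ Suc k))) - real (card (level_set \<beta> F (2 ^ k)))"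
proof -
  have "level_set \<beta> F (2 ^ k) \<subseteq> level_set \<beta> F (2 ^ Suc k)" by (rule level_set_mono) auto
  then show ?thesis
    unfolding shell_def using finite_levelF[of "2 ^ k"] finite_levelF[of "2 ^ Suc k"]
    by (simp add: card_Diff_subset card_mono of_nat_diff del: power_Suc)
qed

lemma shell_disjoint:
  assumes "j < k" shows "shell j \<inter> shell k = {}"
proof -
  have "(2::real) ^ Suc j \<le> 2 ^ k" using assms by (intro power_increasing) auto
  then have "level_set \<beta> F (2 ^ Suc j) \<subseteq> level_set \<beta> F (2 ^ k)" by (intro level_set_mono) auto
  then show ?thesis by (auto simp: shell_def)
qed

lemma finite_shell: "finite (shell k)"
  unfolding shell_def using finite_levelF[of "2 ^ Suc k"] by simp

text \<open>The pairs lie under a hyperbola, and the rectangles \<open>?R k\<close> are inscribed: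
  their two defining inequalities multiply to \<open>1 < \<alpha> e * \<beta> f * \<tau>\<close>.
  Disjoint shells let the cardinalities add.\<close>

lemma lower_dyadic_le_card_product_level:
  assumes "0 < \<tau>"
  shows "lower_dyadic (\<lambda>x. real (card (level_set \<alpha> E x))) (\<lambda>x. real (card (level_set \<beta> F x))) n \<tau> \<le> real (card (product_level \<tau>))"
proof -
  let ?R = "\<lambda>k. level_set \<alpha> E (\<tau> / 2 ^ Suc k) \<times> shell k"
  have "?R k \<subseteq> product_level \<tau>" for k
  proof (rule subrelI)
    fix e f assume "(e, f) \<in> ?R k"
    then have ef: "e \<in> E" "1 < \<alpha> e * (\<tau> / 2 ^ Suc k)" "f \<in> F" "1 < \<beta> f * 2 ^ Suc k"
      using level_set_iff[of "\<tau> / 2 ^ Suc k" e \<alpha> E] level_set_iff[of "2 ^ Suc k" f \<beta> F] assms by (auto simp: shell_def)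
    have "1 < (\<alpha> e * (\<tau> / 2 ^ Suc k)) * (\<beta> f * 2 ^ Suc k)" using less_1_mult[OF ef(2,4)] .
    then show "(e, f) \<in> product_level \<tau>" using ef product_level_iff[OF assms] by (simp add: field_simps)
  qed
  then have "card (\<Union>k<n. ?R k) \<le> card (product_level \<tau>)"
    by (intro card_mono finite_product_level assms) auto
  moreover have "card (\<Union>k<n. ?R k) = (\<Sum>k<n. card (?R k))"
  proof (rule card_UN_disjoint)
    show "\<forall>i\<in>{..<n}. \<forall>j\<in>{..<n}. i \<noteq> j \<longrightarrow> ?R i \<inter> ?R j = {}"
    proof (intro ballI impI)
      fix i j :: nat assume "i \<noteq> j"
      then have "shell i \<inter> shell j = {}"
        using shell_disjoint[of i j] shell_disjoint[of j i] by (cases "i < j") auto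
      then show "?R i \<inter> ?R j = {}" by auto
    qed
    show "\<forall>i\<in>{..<n}. finite (?R i)"
      using assms by (auto intro!: finite_cartesian_product finite_levelE finite_shell)
  qed simp
  moreover have "lower_dyadic (\<lambda>x. real (card (level_set \<alpha> E x))) (\<lambda>x. real (card (level_set \<beta> F x))) n \<tau>
      = real (\<Sum>k<n. card (?R k))"
    by (simp add: lower_dyadic_def card_cartesian_product card_shell del: power_Suc)
  ultimately show ?thesis by linarith
qed

text \<open>Circumscribed rectangles and two leftovers: \<open>?P\<close> takes the \<open>f\<close>
  with \<open>\<beta> f > 1\<close>, which precede all shells, and \<open>?Q\<close> those beyond
  \<open>2 ^ n\<close>, which force \<open>e\<close> into the bounded level \<open>2 * M\<close>.
  Weights may exceed 1, so each member of a pair is only known to lie in level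
  \<open>C * \<tau>\<close>.\<close>

lemma card_product_level_le_upper_dyadic:
  assumes C: "1 \<le> C" "\<And>e. e \<in> E \<Longrightarrow> \<alpha> e \<le> C" "\<And>f. f \<in> F \<Longrightarrow> \<beta> f \<le> C"
    and M: "1 \<le> M" and n: "M * 2 ^ n \<le> \<tau>" "\<tau> < M * 2 ^ Suc n"
  shows "real (card (product_level \<tau>))
    \<le> upper_dyadic (\<lambda>x. real (card (level_set \<alpha> E x))) (\<lambda>x. real (card (level_set \<beta> F x))) n \<tau>
      + (real (card (level_set \<beta> F 1)) + real (card (level_set \<alpha> E (2 * M))))
        * (real (card (level_set \<alpha> E (C * \<tau>))) + real (card (level_set \<beta> F (C * \<tau>))))"
proof -
  have "0 < M * 2 ^ n" using M by simp
  then have \<tau>: "0 < \<tau>" using n(1) by linarith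
  have C\<tau>: "0 < C * \<tau>" using C(1) \<tau> by simp
  let ?R = "\<lambda>k. level_set \<alpha> E (\<tau> / 2 ^ k) \<times> shell k"
  let ?P = "level_set \<alpha> E (C * \<tau>) \<times> level_set \<beta> F 1" and ?Q = "level_set \<alpha> E (2 * M) \<times> level_set \<beta> F (C * \<tau>)"
  have "product_level \<tau> \<subseteq> (\<Union>k<n. ?R k) \<union> ?P \<union> ?Q"
  proof (rule subrelI)
    fix e f assume "(e, f) \<in> product_level \<tau>"
    then have ef: "e \<in> E" "f \<in> F" "1 < \<alpha> e * \<beta> f * \<tau>" using product_level_iff[OF \<tau>] by auto
    note pos = \<alpha>_pos[OF ef(1)] \<beta>_pos[OF ef(2)]
    have "\<alpha> e * \<beta> f * \<tau> \<le> \<alpha> e * C * \<tau>" "\<alpha> e * \<beta> f * \<tau> \<le> C * \<beta> f * \<tau>"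
      using C ef pos \<tau> by (auto intro!: mult_right_mono mult_left_mono)
    then have "1 < \<alpha> e * (C * \<tau>)" "1 < \<beta> f * (C * \<tau>)" using ef(3) by (simp_all add: mult_ac)
    then have eC: "e \<in> level_set \<alpha> E (C * \<tau>)" and fC: "f \<in> level_set \<beta> F (C * \<tau>)"
      using ef by (simp_all add: level_set_iff[OF C\<tau>])
    \<comment> \<open>Outside level \<open>2 ^ k\<close> the weight \<open>\<beta> f\<close> is at
      most \<open>1 / 2 ^ k\<close>, and \<open>\<alpha> e\<close> has to compensate.\<close>
    have out: "1 < \<alpha> e * (\<tau> / 2 ^ k)" if "f \<notin> level_set \<beta> F (2 ^ k)" for k
    proof -
      have "\<beta> f * 2 ^ k \<le> 1" using that ef(2) level_set_iff[of "2 ^ k" f \<beta> F] by simp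
      then have "(\<alpha> e * \<tau> / 2 ^ k) * (\<beta> f * 2 ^ k) \<le> (\<alpha> e * \<tau> / 2 ^ k) * 1"
        using pos \<tau> by (intro mult_left_mono) auto
      moreover have "1 < (\<alpha> e * \<tau> / 2 ^ k) * (\<beta> f * 2 ^ k)" using ef(3) by (simp add: mult_ac)
      ultimately have "1 < (\<alpha> e * \<tau> / 2 ^ k) * 1" by (rule less_le_trans[rotated])
      then show ?thesis by simp
    qed
    \<comment> \<open>The least \<open>m\<close> with \<open>f\<close> in level \<open>2 ^ m\<close>
      locates the shell \<open>m - 1\<close>; \<open>m = 0\<close> is the separate first
      case.\<close>
    consider "f \<in> level_set \<beta> F 1" | "f \<notin> level_set \<beta> F (2 ^ n)" | k where "k < n" "f \<notin> level_set \<beta> F (2 ^ k)" "f \<in> level_set \<beta> F (2 ^ Suc k)"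
    proof (cases "f \<in> level_set \<beta> F (2 ^ n)")
      case True
      define m where "m = (LEAST m. f \<in> level_set \<beta> F (2 ^ m))"
      have m: "f \<in> level_set \<beta> F (2 ^ m)" "m \<le> n"
        unfolding m_def using True by (auto intro: LeastI Least_le)
      show ?thesis
      proof (cases m)
        case 0
        then show ?thesis using m that(1) by simp
      next
        case (Suc k)
        have "f \<notin> level_set \<beta> F (2 ^ k)"
          using not_less_Least[of k "\<lambda>m. f \<in> level_set \<beta> F (2 ^ m)"] Suc by (simp add: m_def)
        then show ?thesis using m Suc that(3)[of k] by simp
      qed
    qed (use that(2) in blast)
    then show "(e, f) \<in> (\<Union>k<n. ?R k) \<union> ?P \<union> ?Q"
    proof cases
      case 1
      then show ?thesis using eC by blast
    next
      case 2
      have "\<tau> / 2 ^ n \<le> 2 * M" using n(2) by (simp add: divide_le_eq mult_ac)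
      then have "\<alpha> e * (\<tau> / 2 ^ n) \<le> \<alpha> e * (2 * M)" using pos by (intro mult_left_mono) auto
      then have "1 < \<alpha> e * (2 * M)" using out[OF 2] by linarith
      then have "e \<in> level_set \<alpha> E (2 * M)" using ef(1) M level_set_iff[of "2 * M" e \<alpha> E] by simp
      then show ?thesis using fC by blast
    next
      case (3 k)
      then have "e \<in> level_set \<alpha> E (\<tau> / 2 ^ k)" using ef(1) \<tau> out[of k] level_set_iff[of "\<tau> / 2 ^ k" e \<alpha> E] by simp
      then show ?thesis using 3 by (auto simp: shell_def)
    qed
  qed
  moreover have fin: "finite (?R k)" "finite ?P" "finite ?Q" for k
    using \<tau> C\<tau> M by (auto intro!: finite_cartesian_product finite_levelE finite_levelF finite_shell)
  ultimately have "card (product_level \<tau>) \<le> card ((\<Union>k<n. ?R k) \<union> ?P \<union> ?Q)"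
    by (intro card_mono) auto
  also have "\<dots> \<le> card (\<Union>k<n. ?R k) + card ?P + card ?Q"
    using card_Un_le[of "(\<Union>k<n. ?R k) \<union> ?P" ?Q] card_Un_le[of "\<Union>k<n. ?R k" ?P] by linarith
  also have "\<dots> \<le> (\<Sum>k<n. card (?R k)) + card ?P + card ?Q"
    by (intro add_mono card_UN_le order_refl) simp
  finally have "real (card (product_level \<tau>)) \<le> real ((\<Sum>k<n. card (?R k)) + card ?P + card ?Q)"
    by (rule of_nat_mono)
  also have "\<dots> = upper_dyadic (\<lambda>x. real (card (level_set \<alpha> E x))) (\<lambda>x. real (card (level_set \<beta> F x))) n \<tau>
      + real (card (level_set \<alpha> E (C * \<tau>))) * real (card (level_set \<beta> F 1))
      + real (card (level_set \<alpha> E (2 * M))) * real (card (level_set \<beta> F (C * \<tau>)))"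
    by (simp add: upper_dyadic_def card_cartesian_product card_shell del: power_Suc)
  also have "\<dots> \<le> upper_dyadic (\<lambda>x. real (card (level_set \<alpha> E x))) (\<lambda>x. real (card (level_set \<beta> F x))) n \<tau>
      + (real (card (level_set \<beta> F 1)) + real (card (level_set \<alpha> E (2 * M))))
        * (real (card (level_set \<alpha> E (C * \<tau>))) + real (card (level_set \<beta> F (C * \<tau>))))"
    by (simp add: algebra_simps)
  finally show ?thesis .
qed

end

section \<open>Asymptotics of the counting function\<close>

text \<open>\<open>dyadic_convolution_le\<close> is used twice: with the counts bounded above by
  \<open>\<phi>\<close> and \<open>\<psi>\<close>, and then with the two pairs of functions
  exchanged.\<close>

lemma card_product_level_asymp_equiv:
  fixes \<alpha> :: "'a \<Rightarrow> real" and \<beta> :: "'b \<Rightarrow> real" and \<phi> \<psi> :: "real \<Rightarrow> real"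
  assumes \<alpha>_pos: "\<And>e. e \<in> E \<Longrightarrow> 0 < \<alpha> e" and \<beta>_pos: "\<And>f. f \<in> F \<Longrightarrow> 0 < \<beta> f"
    and finE: "\<And>t. 0 < t \<Longrightarrow> finite {e \<in> E. t < \<alpha> e}"
    and finF: "\<And>t. 0 < t \<Longrightarrow> finite {f \<in> F. t < \<beta> f}"
    and \<phi>_mono: "\<And>x y. 0 < x \<Longrightarrow> x \<le> y \<Longrightarrow> \<phi> x \<le> \<phi> y" and \<phi>_nonneg: "\<And>x. 0 < x \<Longrightarrow> 0 \<le> \<phi> x"
    and \<psi>_mono: "\<And>x y. 0 < x \<Longrightarrow> x \<le> y \<Longrightarrow> \<psi> x \<le> \<psi> y" and \<psi>_nonneg: "\<And>x. 0 < x \<Longrightarrow> 0 \<le> \<psi> x"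
    and \<phi>_cont: "continuous_on {0<..} \<phi>" and \<psi>_cont: "continuous_on {0<..} \<psi>"
    and \<phi>_slow: "\<And>c. 0 < c \<Longrightarrow> (\<lambda>\<tau>. \<phi> (c * \<tau>)) \<sim>[at_top] \<phi>"
    and \<psi>_slow: "\<And>c. 0 < c \<Longrightarrow> (\<lambda>\<tau>. \<psi> (c * \<tau>)) \<sim>[at_top] \<psi>"
    and \<phi>_top: "filterlim \<phi> at_top at_top" and \<psi>_top: "filterlim \<psi> at_top at_top"
    and a\<phi>: "(\<lambda>x. real (card (level_set \<alpha> E x))) \<sim>[at_top] \<phi>"
    and b\<psi>: "(\<lambda>x. real (card (level_set \<beta> F x))) \<sim>[at_top] \<psi>"
  shows "(\<lambda>x. real (card (level_set (\<lambda>(e, f). \<alpha> e * \<beta> f) (E \<times> F) x))) \<sim>[at_top] (\<phi> \<star> \<psi>)"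
proof -
  define a where "a x = real (card (level_set \<alpha> E x))" for x
  define b where "b x = real (card (level_set \<beta> F x))" for x
  define N where "N x = real (card (level_set (\<lambda>(e, f). \<alpha> e * \<beta> f) (E \<times> F) x))" for x
  note level_assms = \<alpha>_pos \<beta>_pos finE finF
  note conv_assms = \<phi>_mono \<phi>_nonneg \<psi>_mono \<psi>_nonneg \<phi>_cont \<psi>_cont
  have a\<phi>': "a \<sim>[at_top] \<phi>" and b\<psi>': "b \<sim>[at_top] \<psi>"
    using a\<phi> b\<psi> unfolding a_def[abs_def] b_def[abs_def] by auto
  have a_mono: "a x \<le> a y" and b_mono: "b x \<le> b y" if "0 < x" "x \<le> y" for x y
    unfolding a_def b_def of_nat_le_iff
    using that by (intro card_mono finite_level_set[OF finE] finite_level_set[OF finF]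
        level_set_mono; simp)+
  \<comment> \<open>For the exchanged application the counts must themselves vary slowly and tend to
    infinity; both properties pass along asymptotic equivalence.\<close>
  have slow: "(\<lambda>\<tau>. r (c * \<tau>)) \<sim>[at_top] r"
    if r: "r \<sim>[at_top] s" and s: "\<And>c. 0 < c \<Longrightarrow> (\<lambda>\<tau>. s (c * \<tau>)) \<sim>[at_top] s" and c: "0 < c"
    for r s :: "real \<Rightarrow> real" and c
  proof -
    have "filterlim (\<lambda>\<tau>. c * \<tau>) at_top at_top"
      using c by (simp add: filterlim_tendsto_pos_mult_at_top[OF tendsto_const _ filterlim_ident])
    from asymp_equiv_compose'[OF r this] show ?thesis
      using s[OF c] r by (meson asymp_equiv_trans asymp_equiv_symI)
  qed
  have lower_N: "lower_dyadic a b n \<tau> \<le> N \<tau>" if "2 ^ n \<le> \<tau>" for n \<tau>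
  proof -
    have "0 < \<tau>" using that by (smt (verit) zero_less_power)
    then show ?thesis
      using lower_dyadic_le_card_product_level[OF level_assms] unfolding a_def[abs_def] b_def[abs_def] N_def by blast
  qed
  have "N \<sim>[at_top] (\<phi> \<star> \<psi>)"
  proof (rule asymp_equivI_le)
    fix \<epsilon> :: real assume \<epsilon>: "0 < \<epsilon>"
    obtain C where C: "1 \<le> C" "\<And>e. e \<in> E \<Longrightarrow> \<alpha> e \<le> C" "\<And>f. f \<in> F \<Longrightarrow> \<beta> f \<le> C"
      using weights_bounded[OF level_assms] by metis
    have "\<exists>L\<ge>0. \<forall>n \<tau>. M * 2 ^ n \<le> \<tau> \<longrightarrow> \<tau> < M * 2 ^ Suc n \<longrightarrow>
        N \<tau> \<le> upper_dyadic a b n \<tau> + L * (a (C * \<tau>) + b (C * \<tau>))" if "1 \<le> M" for M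
      by (rule exI[of _ "b 1 + a (2 * M)"])
         (use card_product_level_le_upper_dyadic[OF level_assms C that] in
           \<open>auto simp: a_def[abs_def] b_def[abs_def] N_def simp del: power_Suc\<close>)
    then show "eventually (\<lambda>\<tau>. N \<tau> \<le> (1 + \<epsilon>) * (\<phi> \<star> \<psi>) \<tau>) at_top"
      using C(1)
      by (intro dyadic_convolution_le[where f = a and g = b and C = C, OF \<phi>_mono \<phi>_nonneg \<psi>_mono \<psi>_nonneg
          \<phi>_slow \<psi>_slow \<phi>_top \<psi>_top lower_dyadic_le_asymptotic_convolution[OF conv_assms]
          a_mono b_mono _ a\<phi>' b\<psi>' _ _ \<epsilon>]) (simp_all add: b_def)
    \<comment> \<open>The dilation is 1 here, because the integral runs over
      \<open>1 \<le> \<sigma> \<le> \<tau>\<close> and its error involves only values at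
      \<open>\<tau>\<close>.\<close>
    have "\<exists>L\<ge>0. \<forall>n \<tau>. M * 2 ^ n \<le> \<tau> \<longrightarrow> \<tau> < M * 2 ^ Suc n \<longrightarrow>
        (\<phi> \<star> \<psi>) \<tau> \<le> upper_dyadic \<phi> \<psi> n \<tau> + L * (\<phi> (1 * \<tau>) + \<psi> (1 * \<tau>))" if "1 \<le> M" for M
      by (rule exI[of _ "\<phi> (2 * M)"])
         (use asymptotic_convolution_le_upper_dyadic[OF conv_assms that] \<phi>_nonneg[of "2 * M"] that in
           \<open>auto simp del: power_Suc\<close>)
    then show "eventually (\<lambda>\<tau>. (\<phi> \<star> \<psi>) \<tau> \<le> (1 + \<epsilon>) * N \<tau>) at_top"
      by (intro dyadic_convolution_le[where f = \<phi> and g = \<psi> and C = 1, OF a_mono _ b_mono _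
          slow[OF a\<phi>' \<phi>_slow] slow[OF b\<psi>' \<psi>_slow]
          asymp_equiv_at_top_transfer[OF asymp_equiv_symI[OF a\<phi>'] \<phi>_top]
          asymp_equiv_at_top_transfer[OF asymp_equiv_symI[OF b\<psi>'] \<psi>_top] lower_N
          \<phi>_mono \<psi>_mono \<psi>_nonneg asymp_equiv_symI[OF a\<phi>'] asymp_equiv_symI[OF b\<psi>'] _ _ \<epsilon>])
        (simp_all add: a_def b_def)
  next
    \<comment> \<open>The lower dyadic sum with \<open>n = 0\<close> is empty, so the lower bound
      becomes nonnegativity.\<close>
    show "eventually (\<lambda>\<tau>. 0 \<le> (\<phi> \<star> \<psi>) \<tau>) at_top"
      using eventually_ge_at_top[of 1]
      by eventually_elim
        (use lower_dyadic_le_asymptotic_convolution[OF conv_assms, of 0] in \<open>simp add: lower_dyadic_def\<close>)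
  qed
  then show ?thesis unfolding N_def[abs_def] .
qed

lemma slowly_varying_asymp_equiv:
  assumes "slowly_varying \<phi>" "0 < c"
  shows "(\<lambda>\<tau>. \<phi> (c * \<tau>)) \<sim>[at_top] \<phi>"
proof (rule asymp_equivI')
  show "((\<lambda>\<tau>. \<phi> (c * \<tau>) / \<phi> \<tau>) \<longlongrightarrow> 1) at_top"
    using assms by (auto simp: slowly_varying_def)
qed

text \<open>\<open>bounded\<close> is two-sided; positivity ensures that unboundedness occurs
  upwards, and monotonicity then propagates it to infinity.\<close>

lemma mono_unbounded_at_top:
  assumes mono: "mono_on {0<..} \<phi>" and pos: "\<And>x. 0 < x \<Longrightarrow> 0 < \<phi> x"
    and unb: "\<not> bounded (\<phi> ` {0<..})"
  shows "filterlim (\<phi> :: real \<Rightarrow> real) at_top at_top"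
  unfolding filterlim_at_top
proof
  fix Z :: real
  have "\<exists>x>0. Z < \<phi> x"
  proof (rule ccontr)
    assume "\<not> (\<exists>x>0. Z < \<phi> x)"
    then have "\<forall>y\<in>\<phi> ` {0<..}. norm y \<le> Z" using pos by (force simp: not_less less_imp_le)
    then show False using unb by (auto simp: bounded_iff)
  qed
  then obtain x where x: "0 < x" "Z < \<phi> x" by blast
  show "eventually (\<lambda>y. Z \<le> \<phi> y) at_top"
    using eventually_ge_at_top[of x]
  proof eventually_elim
    case (elim y)
    then show ?case using mono_onD[OF mono, of x y] x by auto
  qed
qed

lemma C2_on_continuous_on: "C2_on S f \<Longrightarrow> continuous_on S f"
  unfolding C2_on_def by (meson DERIV_continuous_on)

theorem theorem3p2:
  fixes scaleH :: "'k::rc_field \<Rightarrow> 'a::banach \<Rightarrow> 'a" and ipH :: "'a \<Rightarrow> 'a \<Rightarrow> 'k"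
    and scaleG :: "'k \<Rightarrow> 'b::banach \<Rightarrow> 'b" and ipG :: "'b \<Rightarrow> 'b \<Rightarrow> 'k"
    and scaleK :: "'k \<Rightarrow> 'c::banach \<Rightarrow> 'c" and ipK :: "'c \<Rightarrow> 'c \<Rightarrow> 'k"
    and tensor :: "'a \<Rightarrow> 'b \<Rightarrow> 'c"
    and A :: "'a \<Rightarrow> 'a" and B :: "'b \<Rightarrow> 'b"
    and \<phi> \<psi> :: "real \<Rightarrow> real"
  assumes "hilbert_tensor_product scaleH ipH scaleG ipG scaleK ipK tensor"
    and "compact_operator scaleH A" "self_adjoint ipH A" "nonneg_operator ipH A"
    and "compact_operator scaleG B" "self_adjoint ipG B" "nonneg_operator ipG B"
    and "mono_on {0<..} \<phi>" "\<not> bounded (\<phi> ` {0<..})" "C2_on {0<..} \<phi>" "slowly_varying \<phi>"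
    and "mono_on {0<..} \<psi>" "\<not> bounded (\<psi> ` {0<..})" "C2_on {0<..} \<psi>" "slowly_varying \<psi>"
    and "(\<lambda>t. real (counting_function scaleH t A)) \<sim>[at_right 0] (\<lambda>t. \<phi> (1 / t))"
    and "(\<lambda>t. real (counting_function scaleG t B)) \<sim>[at_right 0] (\<lambda>t. \<psi> (1 / t))"
  shows "(\<lambda>t. real (counting_function scaleK t (tensor_operator scaleK tensor A B)))
           \<sim>[at_right 0] (\<lambda>t. (\<phi> \<star> \<psi>) (1 / t))"
proof -
  interpret hilbert_tensor_product scaleH ipH scaleG ipG scaleK ipK tensor by fact
  obtain E F where EF: "\<And>e. e \<in> E \<Longrightarrow> 0 < norm (A e)" "\<And>f. f \<in> F \<Longrightarrow> 0 < norm (B f)"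
    "\<And>t. 0 < t \<Longrightarrow> finite {e \<in> E. t < norm (A e)}" "\<And>t. 0 < t \<Longrightarrow> finite {f \<in> F. t < norm (B f)}"
    and count: "\<And>t. 0 < t \<Longrightarrow> counting_function scaleH t A = card {e \<in> E. t < norm (A e)}"
    "\<And>t. 0 < t \<Longrightarrow> counting_function scaleG t B = card {f \<in> F. t < norm (B f)}"
    "\<And>t. 0 < t \<Longrightarrow> counting_function scaleK t (tensor_operator scaleK tensor A B)
       = card {(e, f). e \<in> E \<and> f \<in> F \<and> t < norm (A e) * norm (B f)}"
    using counting_functions_tensor[OF assms(2-7)] by blast
  \<comment> \<open>The hypotheses concern \<open>t\<close> near 0 and the pair count concerns
    \<open>x = 1 / t\<close> near infinity; the two filter limits carry equivalences in both
    directions.\<close>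
  have inv_right: "filterlim (\<lambda>x::real. 1 / x) (at_right 0) at_top"
    using filterlim_inverse_at_right_top by (simp add: inverse_eq_divide)
  have inv_top: "filterlim (\<lambda>x::real. 1 / x) at_top (at_right 0)"
    using filterlim_inverse_at_top_right by (simp add: inverse_eq_divide)
  have "(\<lambda>x. real (card (level_set (\<lambda>e. norm (A e)) E x))) \<sim>[at_top] \<phi>"
    by (rule asymp_equiv_transfer[OF asymp_equiv_compose'[OF assms(16) inv_right]];
        rule eventually_mono[OF eventually_gt_at_top[of 0]]) (simp_all add: count level_set_def)
  moreover have "(\<lambda>x. real (card (level_set (\<lambda>f. norm (B f)) F x))) \<sim>[at_top] \<psi>"
    by (rule asymp_equiv_transfer[OF asymp_equiv_compose'[OF assms(17) inv_right]];
        rule eventually_mono[OF eventually_gt_at_top[of 0]]) (simp_all add: count level_set_def)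
  moreover have pos: "0 < \<phi> x" "0 < \<psi> x" if "0 < x" for x
    using assms(11,15) that by (auto simp: slowly_varying_def)
  moreover have "\<phi> x \<le> \<phi> y" "\<psi> x \<le> \<psi> y" if "0 < x" "x \<le> y" for x y
    using mono_onD[OF assms(8), of x y] mono_onD[OF assms(12), of x y] that by auto
  moreover have "filterlim \<phi> at_top at_top" "filterlim \<psi> at_top at_top"
    using mono_unbounded_at_top assms(8,9,12,13) pos by blast+
  ultimately have "(\<lambda>x. real (card (level_set (\<lambda>(e, f). norm (A e) * norm (B f)) (E \<times> F) x))) \<sim>[at_top] (\<phi> \<star> \<psi>)"
    using EF assms(10,11,14,15)
    by (intro card_product_level_asymp_equiv C2_on_continuous_on slowly_varying_asymp_equiv) (auto intro: less_imp_le)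
  note level_equiv = asymp_equiv_compose'[OF this inv_top]
  have "level_set (\<lambda>(e, f). norm (A e) * norm (B f)) (E \<times> F) (1 / t)
      = {(e, f). e \<in> E \<and> f \<in> F \<and> t < norm (A e) * norm (B f)}" for t
    by (auto simp: level_set_def)
  then show ?thesis
    by (intro asymp_equiv_transfer[OF level_equiv] eventually_mono[OF eventually_at_right_less[of 0]])
       (simp_all add: count)
qed

end
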